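(* Let $M=M_{a,b}$ be a local singular arithmetical congruence monoid, with $\gcd(a,b)=p^{\alpha}$ for a prime $p$ and a positive integer $\alpha$, and let $\beta$ be the least positive integer such that $p^{\beta}\in M$. If $\alpha\neq\beta$, then $$\mathrm{LD}(M)=\frac{1}{\delta(\alpha,\beta)},$$ where $\delta(\alpha,\beta)$ denotes the largest integer (strictly) less than $\frac{\beta}{\alpha}$.
   Context: For integers $0<a\le b$ with $a^2\equiv a \pmod b$, the arithmetical congruence monoid (ACM) is $M_{a,b}=\{a+bk : k\in\mathbb{N}_0\}\cup\{1\}$ under multiplication; its only unit is $1$. It is called singular if $\gcd(a,b)\neq1$, and local singular if $\gcd(a,b)$ is a positive power of a single prime. Let $M$ be an ACM. An atom (irreducible) is an element $\neq 1$ that is not a product of two elements of $M\setminus\{1\}$. For $x\in M$, $\mathsf{L}(x)$ is the set of all $\ell\in\mathbb{N}_0$ such that $x$ is a product of $\ell$ atoms of $M$ (counted with multiplicity). Put $\mathrm{L}^{\Delta}(x)=\max\mathsf{L}(x)-\min\mathsf{L}(x)$, and let $M^{LI}=\{x\in M:\mathrm{L}^{\Delta}(x)\neq 0\}$. For $x\in M^{LI}$, the length density of $x$ is $\mathrm{LD}(x)=\dfrac{|\mathsf{L}(x)|-1}{\mathrm{L}^{\Delta}(x)}$, and the length density of $M$ is $\mathrm{LD}(M)=\inf\{\mathrm{LD}(x):x\in M^{LI}\}$. *)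

theory Defs
  imports Complex_Main "HOL-Library.Multiset" "HOL-Number_Theory.Cong"
    "HOL-Computational_Algebra.Primes"
begin

definition acm :: "nat \<Rightarrow> nat \<Rightarrow> nat set" where
  "acm a b = {a + b * k | k. True} \<union> {1}"

text \<open>
  The following notions are stated for a multiplicative submonoid \<open>M\<close> of the positive
  integers, given by its carrier set.
\<close>

definition atoms :: "nat set \<Rightarrow> nat set" where
  "atoms M = {x \<in> M. x \<noteq> 1 \<and> \<not> (\<exists>y \<in> M - {1}. \<exists>z \<in> M - {1}. x = y * z)}"

definition length_set :: "nat set \<Rightarrow> nat \<Rightarrow> nat set" where
  "length_set M x = {l. \<exists>A. set_mset A \<subseteq> atoms M \<and> prod_mset A = x \<and> size A = l}"

text \<open>
  For positive \<open>x\<close> the length set is finite, since atoms of \<open>M\<close> are then at least \<open>2\<close>,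
  so \<^const>\<open>Max\<close> and \<^const>\<open>Min\<close> below have their usual meaning.
\<close>

definition length_spread :: "nat set \<Rightarrow> nat \<Rightarrow> int" where
  "length_spread M x = int (Max (length_set M x)) - int (Min (length_set M x))"

definition length_irregular :: "nat set \<Rightarrow> nat set" where
  "length_irregular M = {x \<in> M. length_spread M x \<noteq> 0}"

definition length_density :: "nat set \<Rightarrow> nat \<Rightarrow> real" where
  "length_density M x = (real (card (length_set M x)) - 1) / real_of_int (length_spread M x)"

definition monoid_length_density :: "nat set \<Rightarrow> real" where
  "monoid_length_density M = Inf {length_density M x | x. x \<in> length_irregular M}"

definition delta :: "nat \<Rightarrow> nat \<Rightarrow> int" where
  "delta \<alpha> \<beta> = (GREATEST n :: int. real_of_int n < real \<beta> / real \<alpha>)"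

end

theory Submission
  imports Defs "HOL-Number_Theory.Number_Theory" "HOL-Computational_Algebra.Squarefree"
    "HOL-Real_Asymp.Real_Asymp"
begin

text \<open>
  Write \<open>b = p\<^sup>\<alpha> f\<close>. Then \<open>M\<close> consists of 1 and the positive multiples of \<open>p\<^sup>\<alpha>\<close> that are 1 modulo \<open>f\<close>,
  so \<open>p\<^sup>\<beta>\<close> is an atom that splits off every element of \<open>p\<close>-adic valuation at least \<open>\<alpha> + \<beta>\<close>; hence
  the valuation of an atom lies in \<open>[\<alpha>, \<alpha> + \<beta>)\<close>.

  Lower bound: consecutive lengths of \<open>x\<close> differ by at most \<open>\<delta>\<close>. If \<open>x = p\<^sup>\<beta> y\<close> in \<open>M\<close>, take any
  factorization of \<open>x\<close> and exchange a minimal part of it of valuation at least \<open>\<alpha> + \<beta>\<close> for \<open>p\<^sup>\<beta>\<close>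
  and further atoms; this moves the length by at most \<open>\<delta>\<close> into \<open>1 + L(y)\<close>, which has small gaps by
  induction.

  Upper bound: for a prime \<open>u\<close> inverse to \<open>p\<^sup>\<alpha>\<close> modulo \<open>f\<close>, the element \<open>(p\<^sup>\<alpha> u)\<^bsup>\<delta>+2\<^esup>\<close> has
  length set \<open>{2, \<delta> + 2}\<close>, the length 2 coming from the factor \<open>p\<^sup>\<beta>\<close>.

  The existence of \<open>u\<close> is Dirichlet's theorem. It is obtained from finite sums in the manner of
  Mertens and Shapiro: for a nonprincipal character \<open>\<chi>\<close>, the sum of \<open>\<chi>(n)\<Lambda>(n)/n\<close> over \<open>n \<le> x\<close> is
  bounded if \<open>L(1,\<chi>) \<noteq> 0\<close> and is \<open>- ln x + O(1)\<close> otherwise. By positivity of the sum over all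
  characters at most one \<open>L(1,\<chi>)\<close> vanishes, so that \<open>\<chi>\<close> is real, which Monsky's argument with Lambert
  series excludes.
\<close>

section \<open>Dirichlet characters\<close>

text \<open>Characters of the unit group modulo \<open>N\<close>, extended by 0 to all natural
  numbers, so that periodicity and complete multiplicativity hold without side conditions.\<close>

definition dirichlet_chars :: "nat \<Rightarrow> (nat \<Rightarrow> complex) set" where
  "dirichlet_chars N = {\<chi>. \<chi> 1 = 1 \<and> (\<forall>m n. \<chi> (m * n) = \<chi> m * \<chi> n) \<and>
     (\<forall>m n. [m = n] (mod N) \<longrightarrow> \<chi> m = \<chi> n) \<and> (\<forall>n. \<chi> n \<noteq> 0 \<longleftrightarrow> coprime n N)}"

text \<open>
  \<open>F'\<close> is a projection \<open>\<Sum>k. z\<^sup>k F(a\<^sup>k x)\<close> of \<open>F\<close> with \<open>z\<close> a root of unity. Iterating this over all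
  residues produces joint eigenfunctions of the translations, whose eigenvalues are the characters.
\<close>
lemma translation_eigenvector:
  fixes F :: "nat \<Rightarrow> complex"
  assumes per: "\<And>m n. [m = n] (mod N) \<Longrightarrow> F m = F n"
    and a: "coprime a N" and "N > 0" and nz: "F x0 \<noteq> 0"
  obtains w F' where "\<And>m n. [m = n] (mod N) \<Longrightarrow> F' m = F' n" "\<exists>x. F' x \<noteq> 0"
    "\<And>x. F' (a * x) = w * F' x"
    "\<And>b v. (\<forall>x. F (b * x) = v * F x) \<Longrightarrow> (\<forall>x. F' (b * x) = v * F' x)"
    "(\<exists>x. F (a * x) \<noteq> F x) \<Longrightarrow> w \<noteq> 1"
proof (cases "\<forall>x. F (a * x) = F x")
  case True
  then show ?thesis using that[of F 1] assms by auto
next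
  case False
  define M where "M = totient N"
  have M: "M > 0" using \<open>N > 0\<close> by (simp add: M_def)
  have aM: "[a ^ M = 1] (mod N)" using euler_theorem[OF a] by (simp add: M_def)
  define G where "G z x = (\<Sum>k<M. z ^ k * F (a ^ k * x))" for z x
  \<comment> \<open>Since \<open>a ^ M\<close> is 1 modulo \<open>N\<close> and
    \<open>z ^ M = 1\<close>, the summands of \<open>G z\<close> are periodic in \<open>k\<close>;
    multiplying by \<open>z\<close> and translating by \<open>a\<close> only shifts the
    index.\<close>
  have shift: "z * G z (a * x) = G z x" if "z ^ M = 1" for z x
  proof -
    define t where "t k = z ^ k * F (a ^ k * x)" for k
    have "[a ^ M * x = 1 * x] (mod N)" using aM by (rule cong_scalar_right)
    then have "t M = t 0" using per that by (auto simp: t_def)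
    moreover have "(\<Sum>k<M. t (Suc k)) + t 0 = (\<Sum>k<M. t k) + t M"
      using sum.lessThan_Suc[of t M] sum.lessThan_Suc_shift[of t M] by (simp add: add.commute)
    moreover have "z * G z (a * x) = (\<Sum>k<M. t (Suc k))"
      by (simp add: G_def t_def sum_distrib_left mult_ac)
    ultimately show ?thesis by (simp add: G_def t_def)
  qed
  \<comment> \<open>By orthogonality of the roots of unity, the average of all projections is
    \<open>F\<close>. If only \<open>z = 1\<close> contributed, \<open>F\<close> would be a multiple
    of \<open>G 1\<close> and thus invariant under translation by \<open>a\<close>.\<close>
  have ex: "\<exists>z x. z ^ M = 1 \<and> z \<noteq> 1 \<and> G z x \<noteq> 0"
  proof (rule ccontr)
    assume *: "\<not> ?thesis"
    define \<zeta> where "\<zeta> j = cis (2 * pi * real j / real M)" for j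
    have bij: "bij_betw \<zeta> {..<M} {z. z ^ M = 1}"
      using bij_betw_roots_unity[OF M] unfolding \<zeta>_def .
    have \<zeta>0: "\<zeta> 0 = 1" by (simp add: \<zeta>_def)
    have root: "\<zeta> j ^ M = 1" if "j < M" for j using bij that by (auto simp: bij_betw_def)
    have ne1: "\<zeta> j \<noteq> 1" if "0 < j" "j < M" for j
      using bij that \<zeta>0 M unfolding bij_betw_def inj_on_def by (metis lessThan_iff less_irrefl)
    have pow: "\<zeta> j ^ k = \<zeta> k ^ j" for j k
      by (simp add: \<zeta>_def Complex.DeMoivre mult_ac)
    have "F x = G 1 x / of_nat M" for x
    proof -
      have geo: "(\<Sum>j<M. \<zeta> j ^ k) = (if k = 0 then of_nat M else 0)" if "k < M" for k
      proof (cases "k = 0")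
        case False
        have "(\<Sum>j<M. \<zeta> k ^ j) = (\<zeta> k ^ M - 1) / (\<zeta> k - 1)"
          using ne1[of k] that False by (intro geometric_sum) auto
        then show ?thesis using root[OF that] False by (simp add: pow)
      qed simp
      have "(\<Sum>j<M. G (\<zeta> j) x) = (\<Sum>j<M. if j = 0 then G 1 x else 0)"
      proof (rule sum.cong)
        fix j assume "j \<in> {..<M}"
        then show "G (\<zeta> j) x = (if j = 0 then G 1 x else 0)"
          using * root[of j] ne1[of j] \<zeta>0 by (cases "j = 0") auto
      qed simp
      then have "G 1 x = (\<Sum>j<M. \<Sum>k<M. \<zeta> j ^ k * F (a ^ k * x))"
        using M by (simp add: G_def sum.delta')
      also have "\<dots> = (\<Sum>k<M. (\<Sum>j<M. \<zeta> j ^ k) * F (a ^ k * x))"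
        by (subst sum.swap) (simp add: sum_distrib_right)
      also have "\<dots> = (\<Sum>k<M. if k = 0 then of_nat M * F x else 0)"
        by (intro sum.cong) (auto simp: geo)
      also have "\<dots> = of_nat M * F x" using M by (simp add: sum.delta')
      finally show ?thesis using M by simp
    qed
    then show False using False shift[of 1] by simp
  qed
  then obtain z x where z: "z ^ M = 1" "z \<noteq> 1" "G z x \<noteq> 0" by blast
  have z0: "z \<noteq> 0" using z M by (auto simp: power_0_left)
  show ?thesis
  proof (rule that[of "G z" "inverse z"])
    show "G z m = G z n" if "[m = n] (mod N)" for m n
      unfolding G_def using that by (intro sum.cong arg_cong2[of _ _ _ _ times] refl per cong_scalar_left)
    show "\<exists>x. G z x \<noteq> 0" using z by blast
    show "G z (a * x) = inverse z * G z x" for x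
      using shift[OF z(1), of x] z0 by (simp add: field_simps)
    show "\<forall>x. G z (b * x) = v * G z x" if "\<forall>x. F (b * x) = v * F x" for b v
    proof
      fix x
      have "F (a ^ k * (b * x)) = v * F (a ^ k * x)" for k
        using that[rule_format, of "a ^ k * x"] by (simp add: mult_ac)
      then show "G z (b * x) = v * G z x" by (simp add: G_def sum_distrib_left mult_ac)
    qed
    show "inverse z \<noteq> 1" using z(2) by simp
  qed
qed

text \<open>The indicator of the class of 1 is not invariant under \<open>a\<close>, so its first
  projection can be chosen with an eigenvalue \<open>w \<noteq> 1\<close>. The later projections
  preserve this equation, and the resulting character satisfies \<open>\<chi> a = w\<close>.\<close>

lemma dirichlet_char_separates:
  assumes N: "N > 0" and a: "coprime a N" and na: "\<not> [a = 1] (mod N)"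
  obtains \<chi> where "\<chi> \<in> dirichlet_chars N" "\<chi> a \<noteq> 1"
proof -
  define F0 :: "nat \<Rightarrow> complex" where "F0 x = (if [x = 1] (mod N) then 1 else 0)" for x
  have h1: "F0 m = F0 n" if "[m = n] (mod N)" for m n
    using that cong_trans cong_sym unfolding F0_def by metis
  have h2: "F0 1 \<noteq> 0" by (simp add: F0_def)
  have h3: "\<exists>x. F0 (a * x) \<noteq> F0 x" using na by (intro exI[of _ 1]) (simp add: F0_def)
  obtain w :: complex and F1 where F1: "\<And>m n. [m = n] (mod N) \<Longrightarrow> F1 m = F1 n" "\<exists>x. F1 x \<noteq> 0"
    "\<And>x. F1 (a * x) = w * F1 x" and w: "w \<noteq> 1"
    by (rule translation_eigenvector[of N F0 a 1, OF h1 a N h2]) (use h3 in auto)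
  have "finite S \<Longrightarrow> S \<subseteq> {b. coprime b N} \<Longrightarrow> \<exists>F::nat \<Rightarrow> complex. (\<forall>m n. [m = n] (mod N) \<longrightarrow> F m = F n)
      \<and> (\<exists>x. F x \<noteq> 0) \<and> (\<forall>x. F (a * x) = w * F x) \<and> (\<forall>b\<in>S. \<exists>v. \<forall>x. F (b * x) = v * F x)" for S
  proof (induction S rule: finite_induct)
    case empty
    then show ?case using F1 by blast
  next
    case (insert c S)
    then obtain F where F: "\<forall>m n. [m = n] (mod N) \<longrightarrow> F m = F n" "\<exists>x. F x \<noteq> 0"
      "\<forall>x. F (a * x) = w * F x" "\<forall>b\<in>S. \<exists>v. \<forall>x. F (b * x) = v * F x" by auto
    then obtain x0 where nz: "F x0 \<noteq> 0" by blast
    have c: "coprime c N" using insert by auto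
    have per: "\<And>m n. [m = n] (mod N) \<Longrightarrow> F m = F n" using F(1) by blast
    obtain u F' where *: "\<And>m n. [m = n] (mod N) \<Longrightarrow> F' m = F' n" "\<exists>x. F' x \<noteq> 0"
      "\<And>x. F' (c * x) = u * F' x"
      "\<And>b v. (\<forall>x. F (b * x) = v * F x) \<Longrightarrow> (\<forall>x. F' (b * x) = v * F' x)"
      by (rule translation_eigenvector[of N F c x0, OF per c N nz]) auto
    show ?case
    proof (intro exI[of _ F'] conjI)
      show "\<forall>x. F' (a * x) = w * F' x" using *(4) F(3) by blast
      show "\<forall>b\<in>insert c S. \<exists>v. \<forall>x. F' (b * x) = v * F' x" using *(3,4) F(4) by blast
    qed (use * in blast)+
  qed
  from this[of "{b. b < N \<and> coprime b N}"]
  have "\<exists>F::nat \<Rightarrow> complex. (\<forall>m n. [m = n] (mod N) \<longrightarrow> F m = F n) \<and> (\<exists>x. F x \<noteq> 0) \<and>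
      (\<forall>x. F (a * x) = w * F x) \<and> (\<forall>b. b < N \<and> coprime b N \<longrightarrow> (\<exists>v. \<forall>x. F (b * x) = v * F x))"
    by auto
  then obtain F :: "nat \<Rightarrow> complex" and x0 where F: "\<forall>m n. [m = n] (mod N) \<longrightarrow> F m = F n"
    and x0: "F x0 \<noteq> 0" and Fa: "\<forall>x. F (a * x) = w * F x"
    and Fb: "\<forall>b. b < N \<and> coprime b N \<longrightarrow> (\<exists>v. \<forall>x. F (b * x) = v * F x)"
    by (elim exE conjE) (rule that)
  \<comment> \<open>The quotient reads off the eigenvalue of translation by \<open>n\<close>;
    \<open>x0\<close> is a point where \<open>F\<close> does not vanish.\<close>
  define \<chi> where "\<chi> n = (if coprime n N then F (n * x0) / F x0 else 0)" for n
  have eig: "F (n * x) = \<chi> n * F x" if "coprime n N" for n x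
  proof -
    have "n mod N < N" "coprime (n mod N) N" using N that by auto
    then obtain v where v: "\<forall>x. F (n mod N * x) = v * F x" using Fb by blast
    have "F (n * x) = F (n mod N * x)" for x
      by (intro F[rule_format]) (simp add: Cong.cong_def mod_mult_left_eq)
    then show ?thesis using v x0 that by (simp add: \<chi>_def)
  qed
  have "\<chi> n \<noteq> 0 \<longleftrightarrow> coprime n N" for n
  proof
    assume c: "coprime n N"
    then obtain m where m: "[n * m = 1] (mod N)" using cong_solve_coprime_nat[OF c] by auto
    have "F (n * (m * x0)) = F x0"
      using cong_scalar_right[OF m, of x0] by (intro F[rule_format]) (simp add: mult.assoc)
    then show "\<chi> n \<noteq> 0" using eig[OF c, of "m * x0"] x0 by auto
  qed (simp add: \<chi>_def split: if_splits)
  moreover have "\<chi> (m * n) = \<chi> m * \<chi> n" for m n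
  proof (cases "coprime m N \<and> coprime n N")
    case True
    then have "coprime (m * n) N" by simp
    then show ?thesis using True eig[of "m * n" x0] eig[of m "n * x0"] eig[of n x0] x0 by (simp add: mult.assoc)
  next
    case False
    then have "\<not> coprime (m * n) N" by simp
    then show ?thesis using False by (auto simp: \<chi>_def)
  qed
  moreover have "\<chi> m = \<chi> n" if "[m = n] (mod N)" for m n
  proof -
    have "coprime m N \<longleftrightarrow> coprime n N" using that cong_imp_coprime cong_sym by blast
    moreover have "F (m * x0) = F (n * x0)" using that by (intro F[rule_format] cong_scalar_right)
    ultimately show ?thesis by (simp add: \<chi>_def)
  qed
  moreover have "\<chi> 1 = 1" using x0 by (simp add: \<chi>_def)
  ultimately have "\<chi> \<in> dirichlet_chars N" unfolding dirichlet_chars_def by blast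
  moreover have "\<chi> a = w" using eig[OF a, of x0] Fa x0 by auto
  ultimately show ?thesis using that w by blast
qed

lemma dirichlet_charsD:
  assumes "\<chi> \<in> dirichlet_chars N"
  shows "\<chi> 1 = 1" "\<chi> (m * n) = \<chi> m * \<chi> n" "[m = n] (mod N) \<Longrightarrow> \<chi> m = \<chi> n"
    "\<chi> n = 0 \<longleftrightarrow> \<not> coprime n N"
  using assms unfolding dirichlet_chars_def by blast+

lemma dirichlet_char_power:
  assumes "\<chi> \<in> dirichlet_chars N"
  shows "\<chi> (n ^ k) = \<chi> n ^ k"
  by (induction k) (use dirichlet_charsD(1,2)[OF assms] in auto)

lemma dirichlet_char_root_of_unity:
  assumes "\<chi> \<in> dirichlet_chars N" "coprime n N"
  shows "\<chi> n ^ totient N = 1"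
  using dirichlet_charsD(1)[OF assms(1)] dirichlet_charsD(3)[OF assms(1) euler_theorem[OF assms(2)]]
  by (simp flip: dirichlet_char_power[OF assms(1)])

lemma norm_dirichlet_char:
  assumes "\<chi> \<in> dirichlet_chars N" "N > 0" "coprime n N"
  shows "norm (\<chi> n) = 1"
proof -
  have "norm (\<chi> n) ^ totient N = 1"
    using dirichlet_char_root_of_unity[OF assms(1,3)] by (metis norm_one norm_power)
  then show ?thesis
    using power_eq_imp_eq_base[of "norm (\<chi> n)" "totient N" 1] assms(2) by simp
qed

lemma norm_dirichlet_char_le:
  assumes "\<chi> \<in> dirichlet_chars N" "N > 0"
  shows "norm (\<chi> n) \<le> 1"
  using norm_dirichlet_char[OF assms, of n] dirichlet_charsD(4)[OF assms(1), of n] by fastforce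

lemma principal_dirichlet_char:
  assumes "N > 0"
  shows "(\<lambda>n. if coprime n N then 1 else 0) \<in> dirichlet_chars N"
proof -
  have "coprime m N \<longleftrightarrow> coprime n N" if "[m = n] (mod N)" for m n
    using that cong_imp_coprime cong_sym by blast
  then show ?thesis by (simp add: dirichlet_chars_def)
qed

lemma cnj_dirichlet_char:
  assumes "\<chi> \<in> dirichlet_chars N"
  shows "(\<lambda>n. cnj (\<chi> n)) \<in> dirichlet_chars N"
proof -
  have "cnj (\<chi> m) = cnj (\<chi> n)" if "[m = n] (mod N)" for m n
    using dirichlet_charsD(3)[OF assms that] by simp
  moreover have "cnj (\<chi> 1) = 1" "\<And>m n. cnj (\<chi> (m * n)) = cnj (\<chi> m) * cnj (\<chi> n)"
    "\<And>n. cnj (\<chi> n) \<noteq> 0 \<longleftrightarrow> coprime n N"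
    using dirichlet_charsD(1,2,4)[OF assms] by simp_all
  ultimately show ?thesis unfolding dirichlet_chars_def by blast
qed

lemma times_dirichlet_char:
  assumes "\<chi> \<in> dirichlet_chars N" "\<psi> \<in> dirichlet_chars N"
  shows "(\<lambda>n. \<chi> n * \<psi> n) \<in> dirichlet_chars N"
proof -
  note D = dirichlet_charsD[OF assms(1)] dirichlet_charsD[OF assms(2)]
  have "\<chi> m * \<psi> m = \<chi> n * \<psi> n" if "[m = n] (mod N)" for m n
    using D(3)[OF that] D(7)[OF that] by simp
  moreover have "\<chi> 1 * \<psi> 1 = 1" using D(1,5) by simp
  moreover have "\<chi> (m * n) * \<psi> (m * n) = \<chi> m * \<psi> m * (\<chi> n * \<psi> n)" for m n
    using D(2)[of m n] D(6)[of m n] by simp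
  moreover have "\<chi> n * \<psi> n \<noteq> 0 \<longleftrightarrow> coprime n N" for n
    using D(4)[of n] D(8)[of n] by simp
  ultimately show ?thesis unfolding dirichlet_chars_def by blast
qed

text \<open>A character is determined by its values below \<open>N\<close>, each of which is 0 or a
  root of unity of order dividing \<open>totient N\<close>.\<close>

lemma finite_dirichlet_chars:
  assumes "N > 0"
  shows "finite (dirichlet_chars N)"
proof -
  define R where "R = insert 0 {z::complex. z ^ totient N = 1}"
  have fin: "finite (PiE {..<N} (\<lambda>_. R))"
    unfolding R_def using assms by (intro finite_PiE) (auto intro!: finite_roots_unity simp: Suc_le_eq)
  show ?thesis
  proof (rule inj_on_finite[OF _ _ fin])
    show "inj_on (\<lambda>\<chi>. restrict \<chi> {..<N}) (dirichlet_chars N)"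
    proof (rule inj_onI)
      fix \<chi> \<psi> assume *: "\<chi> \<in> dirichlet_chars N" "\<psi> \<in> dirichlet_chars N"
        "restrict \<chi> {..<N} = restrict \<psi> {..<N}"
      show "\<chi> = \<psi>"
      proof
        fix n
        have c: "[n = n mod N] (mod N)" by simp
        have "\<chi> (n mod N) = \<psi> (n mod N)"
          using fun_cong[OF *(3), of "n mod N"] assms by simp
        then show "\<chi> n = \<psi> n"
          using dirichlet_charsD(3)[OF *(1) c] dirichlet_charsD(3)[OF *(2) c] by simp
      qed
    qed
    show "(\<lambda>\<chi>. restrict \<chi> {..<N}) ` dirichlet_chars N \<subseteq> PiE {..<N} (\<lambda>_. R)"
    proof (rule image_subsetI)
      fix \<chi> assume \<chi>: "\<chi> \<in> dirichlet_chars N"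
      have "\<chi> n \<in> R" for n
        using dirichlet_char_root_of_unity[OF \<chi>, of n] dirichlet_charsD(4)[OF \<chi>, of n]
        unfolding R_def by blast
      then show "restrict \<chi> {..<N} \<in> PiE {..<N} (\<lambda>_. R)" by simp
    qed
  qed
qed

text \<open>For a unit \<open>n\<close> other than 1, multiplication by a character
  \<open>\<psi>\<close> with \<open>\<psi> n \<noteq> 1\<close> permutes the characters, with
  inverse multiplication by its conjugate; so the sum is unchanged by a factor other than 1.\<close>

lemma sum_dirichlet_chars:
  assumes N: "N > 0"
  shows "(\<Sum>\<chi>\<in>dirichlet_chars N. \<chi> n) = (if [n = 1] (mod N) then of_nat (card (dirichlet_chars N)) else 0)"
proof -
  consider "[n = 1] (mod N)" | "\<not> coprime n N" | "\<not> [n = 1] (mod N)" "coprime n N" by blast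
  then show ?thesis
  proof cases
    case 1
    then have "\<chi> n = 1" if "\<chi> \<in> dirichlet_chars N" for \<chi>
      using dirichlet_charsD(1)[OF that] dirichlet_charsD(3)[OF that 1] by simp
    then have "(\<Sum>\<chi>\<in>dirichlet_chars N. \<chi> n) = (\<Sum>\<chi>\<in>dirichlet_chars N. 1)" by (rule sum.cong[OF refl])
    then show ?thesis using 1 by simp
  next
    case 2
    then have "\<not> [n = 1] (mod N)" using cong_imp_coprime cong_sym coprime_1_left by blast
    then show ?thesis using 2 dirichlet_charsD(4) by (auto intro!: sum.neutral)
  next
    case 3
    then obtain \<psi> where \<psi>: "\<psi> \<in> dirichlet_chars N" "\<psi> n \<noteq> 1"
      using dirichlet_char_separates[OF N] by blast
    have inv: "\<psi> k * cnj (\<psi> k) = (if coprime k N then 1 else 0)" for k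
    proof (cases "coprime k N")
      case True
      then show ?thesis
        using norm_dirichlet_char[OF \<psi>(1) N True] complex_norm_square[of "\<psi> k"] by simp
    next
      case False
      then show ?thesis using dirichlet_charsD(4)[OF \<psi>(1), of k] by simp
    qed
    have canc: "\<chi> k * (\<psi> k * cnj (\<psi> k)) = \<chi> k" if "\<chi> \<in> dirichlet_chars N" for \<chi> k
      using dirichlet_charsD(4)[OF that, of k] by (auto simp: inv)
    have "(\<Sum>\<chi>\<in>dirichlet_chars N. \<chi> n * \<psi> n) = (\<Sum>\<chi>\<in>dirichlet_chars N. \<chi> n)"
    proof (rule sum.reindex_bij_witness[where
          i = "\<lambda>\<chi> k. \<chi> k * cnj (\<psi> k)" and j = "\<lambda>\<chi> k. \<chi> k * \<psi> k"])
      fix \<chi> assume \<chi>: "\<chi> \<in> dirichlet_chars N"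
      show "(\<lambda>k. (\<chi> k * \<psi> k) * cnj (\<psi> k)) = \<chi>" using canc[OF \<chi>] by (intro ext) (simp only: mult.assoc)
      show "(\<lambda>k. (\<chi> k * cnj (\<psi> k)) * \<psi> k) = \<chi>" using canc[OF \<chi>] by (intro ext) (simp only: mult.assoc mult.commute[of "cnj _"])
      show "(\<lambda>k. \<chi> k * \<psi> k) \<in> dirichlet_chars N" by (rule times_dirichlet_char[OF \<chi> \<psi>(1)])
      show "(\<lambda>k. \<chi> k * cnj (\<psi> k)) \<in> dirichlet_chars N"
        by (rule times_dirichlet_char[OF \<chi> cnj_dirichlet_char[OF \<psi>(1)]])
    qed simp
    then have "(\<Sum>\<chi>\<in>dirichlet_chars N. \<chi> n) * (\<psi> n - 1) = 0"
      by (simp add: sum_distrib_right right_diff_distrib)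
    then show ?thesis using \<psi>(2) 3 by simp
  qed
qed

text \<open>Multiplication by \<open>a\<close> permutes the residues, so the sum equals its multiple
  by \<open>\<chi> a \<noteq> 1\<close>.\<close>

lemma dirichlet_char_sum_residues:
  assumes "\<chi> \<in> dirichlet_chars N" and N: "N > 0" and a: "coprime a N" "\<chi> a \<noteq> 1"
  shows "(\<Sum>n<N. \<chi> n) = 0"
proof -
  have bij: "bij_betw (\<lambda>n. a * n mod N) {..<N} {..<N}"
  proof -
    have "inj_on (\<lambda>n. a * n mod N) {..<N}"
    proof (rule inj_onI)
      fix x y assume *: "x \<in> {..<N}" "y \<in> {..<N}" "a * x mod N = a * y mod N"
      then have "[x = y] (mod N)" using cong_mult_lcancel_nat[OF a(1), of x y] by (simp add: Cong.cong_def)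
      then show "x = y" using * by (simp add: Cong.cong_def)
    qed
    moreover have "(\<lambda>n. a * n mod N) ` {..<N} \<subseteq> {..<N}" using N by auto
    ultimately show ?thesis by (simp add: bij_betw_def endo_inj_surj)
  qed
  have "(\<Sum>n<N. \<chi> n) = (\<Sum>n<N. \<chi> (a * n mod N))"
    by (rule sum.reindex_bij_betw[OF bij, symmetric])
  also have "\<dots> = (\<Sum>n<N. \<chi> (a * n))"
    by (intro sum.cong dirichlet_charsD(3)[OF assms(1)]) auto
  also have "\<dots> = \<chi> a * (\<Sum>n<N. \<chi> n)"
    by (simp only: dirichlet_charsD(2)[OF assms(1)] sum_distrib_left)
  finally have "(\<chi> a - 1) * (\<Sum>n<N. \<chi> n) = 0" by (simp add: algebra_simps)
  then show ?thesis using a(2) by simp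
qed

text \<open>Full periods cancel, and fewer than \<open>N\<close> terms remain, each of norm at most
  1.\<close>

lemma norm_dirichlet_char_sum_le:
  assumes "\<chi> \<in> dirichlet_chars N" and N: "N > 0" and a: "coprime a N" "\<chi> a \<noteq> 1"
  shows "norm (\<Sum>n<k. \<chi> n) \<le> N"
proof (induction k rule: less_induct)
  case (less k)
  show ?case
  proof (cases "k < N")
    case True
    have "norm (\<Sum>n<k. \<chi> n) \<le> (\<Sum>n<k. 1)"
      by (intro sum_norm_le) (use norm_dirichlet_char_le[OF assms(1,2)] in auto)
    then show ?thesis using True by simp
  next
    case False
    then obtain l where l: "k = N + l" using le_Suc_ex not_less by blast
    have "(\<Sum>n<k. \<chi> n) = (\<Sum>n<N. \<chi> n) + (\<Sum>n<l. \<chi> (n + N))"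
      unfolding l by (induction l) (simp_all add: add_ac)
    also have "(\<Sum>n<l. \<chi> (n + N)) = (\<Sum>n<l. \<chi> n)"
      by (intro sum.cong dirichlet_charsD(3)[OF assms(1)]) (auto simp: Cong.cong_def)
    finally show ?thesis using less[of l] l N dirichlet_char_sum_residues[OF assms] by simp
  qed
qed

section \<open>The Moebius function and Abel summation\<close>

definition moebius_mu :: "nat \<Rightarrow> 'a :: comm_ring_1" where
  "moebius_mu n = (if squarefree n then (-1) ^ card (prime_factors n) else 0)"

lemma moebius_1 [simp]: "moebius_mu (Suc 0) = 1"
  by (simp add: moebius_mu_def)

lemma norm_moebius_le: "norm (moebius_mu n :: 'a :: {comm_ring_1, real_normed_algebra_1}) \<le> 1"
  by (simp add: moebius_mu_def minus_one_power_iff)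

lemma moebius_prime_times:
  assumes "prime p" "\<not> p dvd d"
  shows "moebius_mu (p * d) = (- moebius_mu d :: 'a :: comm_ring_1)"
proof -
  have d: "d \<noteq> 0" using assms(2) by (metis dvd_0_right)
  have "coprime p d" using assms prime_imp_coprime by blast
  then have "squarefree (p * d) \<longleftrightarrow> squarefree d"
    using squarefree_mult_coprime[of p d] squarefree_prime[OF assms(1)] squarefree_mono[of d "p * d"]
    by auto
  moreover have "prime_factors (p * d) = insert p (prime_factors d)"
    using d assms by (simp add: prime_factors_product prime_prime_factors prime_gt_0_nat)
  moreover have "p \<notin> prime_factors d" using assms by auto
  ultimately show ?thesis by (simp add: moebius_mu_def)
qed

text \<open>For a prime \<open>p\<close> dividing \<open>n\<close>, the squarefree divisors pair off
  as \<open>d\<close> and \<open>p * d\<close> with opposite signs.\<close>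

lemma sum_divisors_moebius:
  assumes "n > 0"
  shows "(\<Sum>d | d dvd n. moebius_mu d) = (if n = 1 then 1 else 0 :: 'a :: comm_ring_1)"
proof (cases "n = 1")
  case False
  then obtain p where p: "prime p" "p dvd n" using prime_factor_nat by blast
  define A where "A = {d. d dvd n \<and> \<not> p dvd d}"
  define B where "B = {d. d dvd n \<and> p dvd d}"
  have fin: "finite {d. d dvd n}" using assms by simp
  have "{d. d dvd n} = A \<union> B" "A \<inter> B = {}" by (auto simp: A_def B_def)
  moreover have "finite A" "finite B"
    by (auto simp: A_def B_def intro: finite_subset[OF _ fin])
  ultimately have "(\<Sum>d | d dvd n. moebius_mu d) = (\<Sum>d\<in>A. moebius_mu d) + (\<Sum>d\<in>B. moebius_mu d :: 'a)"
    by (simp add: sum.union_disjoint)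
  moreover have "(\<Sum>d\<in>B. moebius_mu d :: 'a) = (\<Sum>d\<in>(\<lambda>d. p * d) ` A. moebius_mu d)"
  proof (rule sum.mono_neutral_right)
    show "finite B" by fact
    show "(\<lambda>d. p * d) ` A \<subseteq> B"
      using p unfolding A_def B_def
      by (auto intro: divides_mult simp: prime_imp_coprime)
    show "\<forall>d\<in>B - (\<lambda>d. p * d) ` A. moebius_mu d = (0 :: 'a)"
    proof
      fix d assume d: "d \<in> B - (\<lambda>d. p * d) ` A"
      then obtain e where e: "d = p * e" by (auto simp: B_def)
      moreover from this d have "e dvd n" by (auto simp: B_def dest: dvd_mult_right)
      ultimately have "p dvd e" using d by (auto simp: A_def)
      then have "p ^ 2 dvd d" using e by (auto simp: power2_eq_square)
      then have "\<not> squarefree d" using p(1) unfolding squarefree_def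
        by (metis not_prime_unit)
      then show "moebius_mu d = (0 :: 'a)" by (simp add: moebius_mu_def)
    qed
  qed
  moreover have "\<dots> = (\<Sum>d\<in>A. moebius_mu (p * d) :: 'a)"
    using p(1) by (subst sum.reindex) (auto intro: inj_onI)
  moreover have "\<dots> = (\<Sum>d\<in>A. - moebius_mu d)"
    by (intro sum.cong moebius_prime_times p refl) (simp add: A_def)
  ultimately show ?thesis using False by (simp add: sum_negf)
qed simp

text \<open>Both sides run over the pairs \<open>(d, m)\<close> of positive numbers with
  \<open>d * m \<le> x\<close>.\<close>

lemma sum_divisors_swap:
  fixes f :: "nat \<Rightarrow> nat \<Rightarrow> 'a :: comm_monoid_add"
  shows "(\<Sum>n=1..x. \<Sum>d | d dvd n. f d (n div d)) = (\<Sum>d=1..x. \<Sum>m=1..x div d. f d m)"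
proof -
  have pos: "0 < d \<and> d \<le> x" if "d dvd n" "0 < n" "n \<le> x" for d n :: nat
    using that dvd_imp_le[of d n] dvd_pos_nat[of n d] by linarith
  have "(\<Sum>n=1..x. \<Sum>d | d dvd n. f d (n div d)) = (\<Sum>(n,d)\<in>Sigma {1..x} (\<lambda>n. {d. d dvd n}). f d (n div d))"
    by (intro sum.Sigma) auto
  also have "\<dots> = (\<Sum>(d,m)\<in>Sigma {1..x} (\<lambda>d. {1..x div d}). f d m)"
    by (rule sum.reindex_bij_witness[of _ "\<lambda>(d,m). (d * m, d)" "\<lambda>(n,d). (d, n div d)"])
      (auto simp: div_le_mono Suc_le_eq dvd_div_eq_0_iff less_eq_div_iff_mult_less_eq mult.commute
         dest: dvd_imp_le intro: Nat.gr0I simp: pos)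
  also have "\<dots> = (\<Sum>d=1..x. \<Sum>m=1..x div d. f d m)"
    by (intro sum.Sigma[symmetric]) auto
  finally show ?thesis .
qed

text \<open>Moebius inversion of the identity that \<open>ln n\<close> is the sum of the von
  Mangoldt function over the divisors of \<open>n\<close>.\<close>

lemma sum_moebius_ln:
  assumes "n > 0"
  shows "(\<Sum>d | d dvd n. moebius_mu d * of_real (ln (real (n div d)))) =
    (mangoldt n :: 'a :: {real_algebra_1, comm_ring_1})"
proof -
  have fin: "finite {d. d dvd n}" using assms by simp
  have "(\<Sum>d | d dvd n. moebius_mu d * of_real (ln (real (n div d)))) =
      (\<Sum>d | d dvd n. \<Sum>e | e dvd n div d. moebius_mu d * (mangoldt e :: 'a))"
  proof (rule sum.cong[OF refl])
    fix d assume "d \<in> {d. d dvd n}"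
    then have "n div d \<noteq> 0" using assms by (auto simp: dvd_div_eq_0_iff)
    from mangoldt_sum[OF this, where ?'a = 'a]
    show "moebius_mu d * of_real (ln (real (n div d))) = (\<Sum>e | e dvd n div d. moebius_mu d * (mangoldt e :: 'a))"
      by (simp add: sum_distrib_left[symmetric])
  qed
  also have "\<dots> = (\<Sum>(d,e)\<in>Sigma {d. d dvd n} (\<lambda>d. {e. e dvd n div d}). moebius_mu d * (mangoldt e :: 'a))"
    using assms by (intro sum.Sigma) (auto simp: dvd_div_eq_0_iff)
  also have "\<dots> = (\<Sum>(e,d)\<in>Sigma {d. d dvd n} (\<lambda>d. {e. e dvd n div d}). moebius_mu d * (mangoldt e :: 'a))"
  proof -
    have *: "e dvd n div d \<longleftrightarrow> d * e dvd n" if "d dvd n" for d e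
      using that assms by (metis dvd_div_iff_mult dvd_0_left_iff mult.commute not_gr_zero)
    have "e dvd n \<and> d dvd n div e" if "d dvd n" "e dvd n div d" for d e
      using that * by (metis dvd_mult_left dvd_mult_right mult.commute)
    then show ?thesis
      by (intro sum.reindex_bij_witness[of _ "\<lambda>(d,m). (m, d)" "\<lambda>(n,d). (d, n)"]) auto
  qed
  also have "\<dots> = (\<Sum>e | e dvd n. \<Sum>d | d dvd n div e. moebius_mu d * (mangoldt e :: 'a))"
    using assms by (intro sum.Sigma[symmetric]) (auto simp: dvd_div_eq_0_iff)
  also have "\<dots> = (\<Sum>e | e dvd n. if e = n then mangoldt n else 0)"
  proof (rule sum.cong[OF refl])
    fix e assume e: "e \<in> {e. e dvd n}"
    then have "n div e > 0" using assms by (auto simp: dvd_div_eq_0_iff intro: Nat.gr0I)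
    moreover have "n div e = 1 \<longleftrightarrow> e = n"
      using e assms by (metis div_self dvd_div_mult_self mem_Collect_eq mult_1 not_gr_zero)
    ultimately show "(\<Sum>d | d dvd n div e. moebius_mu d * (mangoldt e :: 'a)) = (if e = n then mangoldt n else 0)"
      by (simp only: sum_distrib_right[symmetric] sum_divisors_moebius) simp
  qed
  also have "\<dots> = mangoldt n" using fin by (simp add: sum.delta)
  finally show ?thesis .
qed

section \<open>Abel summation\<close>

text \<open>Summation by parts: up to the boundary term \<open>S k * g k\<close>, the weighted sum
  consists of values of \<open>S\<close> times decrements of \<open>g\<close>, and the decrements
  telescope.\<close>

lemma abel_sum_bound:
  fixes c :: "nat \<Rightarrow> complex" and g :: "nat \<Rightarrow> real"
  assumes D: "\<And>k. norm (\<Sum>n=m..<k. c n) \<le> D"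
    and dec: "\<And>n. n \<ge> m \<Longrightarrow> g (Suc n) \<le> g n" and pos: "\<And>n. n \<ge> m \<Longrightarrow> g n \<ge> 0"
  shows "norm (\<Sum>n=m..<k. c n * of_real (g n)) \<le> D * g m"
proof (cases "m \<le> k")
  case True
  define S where "S k = (\<Sum>n=m..<k. c n)" for k
  define T where "T k = (\<Sum>n=m..<k. c n * of_real (g n))" for k
  have "norm (T k - S k * of_real (g k)) \<le> D * (g m - g k)"
    using True
  proof (induction k rule: dec_induct)
    case base
    then show ?case by (simp add: S_def T_def)
  next
    case (step k)
    have "T (Suc k) - S (Suc k) * of_real (g (Suc k)) =
        (T k - S k * of_real (g k)) + S (Suc k) * of_real (g k - g (Suc k))"
      using step by (simp add: S_def T_def algebra_simps)
    also have "norm \<dots> \<le> D * (g m - g k) + D * (g k - g (Suc k))"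
    proof (rule norm_triangle_le, rule add_mono)
      show "norm (S (Suc k) * of_real (g k - g (Suc k))) \<le> D * (g k - g (Suc k))"
        using D[of "Suc k"] dec[of k] step
        by (simp add: norm_mult S_def mult_right_mono del: of_real_diff sum.op_ivl_Suc)
    qed (rule step)
    finally show ?case by (simp add: algebra_simps)
  qed
  moreover have "norm (S k * of_real (g k)) \<le> D * g k"
    using D[of k] pos[of k] True by (simp add: norm_mult S_def mult_right_mono)
  ultimately have "norm ((T k - S k * of_real (g k)) + S k * of_real (g k)) \<le> D * (g m - g k) + D * g k"
    by (intro norm_triangle_le add_mono)
  then show ?thesis by (simp add: T_def algebra_simps)
next
  case False
  then show ?thesis using D[of 0] pos[of m] by simp
qed

text \<open>A bound on the sums over all intervals bounds every tail by
  \<open>D * g (Suc x)\<close>. This yields both the Cauchy property and, in the limit, the explicit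
  rate of convergence.\<close>

lemma abel_sum_converges:
  fixes c :: "nat \<Rightarrow> complex" and g :: "nat \<Rightarrow> real"
  assumes D: "\<And>m k. norm (\<Sum>n=m..<k. c n) \<le> D"
    and dec: "\<And>n. n \<ge> 1 \<Longrightarrow> g (Suc n) \<le> g n" and lim: "g \<longlonglongrightarrow> 0"
  obtains L where "\<And>x. norm ((\<Sum>n=1..x. c n * of_real (g n)) - L) \<le> D * g (Suc x)"
    "(\<lambda>x. \<Sum>n=1..x. c n * of_real (g n)) \<longlonglongrightarrow> L"
proof -
  have pos: "g n \<ge> 0" if "n \<ge> 1" for n
  proof (rule LIMSEQ_le_const2[OF lim])
    have "g k \<le> g n" if "k \<ge> n" for k
      using that by (induction k rule: dec_induct) (use dec \<open>n \<ge> 1\<close> in \<open>auto intro: order_trans\<close>)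
    then show "\<exists>N. \<forall>k\<ge>N. g k \<le> g n" by blast
  qed
  define T where "T x = (\<Sum>n=1..x. c n * of_real (g n))" for x
  have diff: "norm (T y - T x) \<le> D * g (Suc x)" if "x \<le> y" for x y
  proof -
    have "T y = T x + (\<Sum>n=Suc x..<Suc y. c n * of_real (g n))"
      using that unfolding T_def by (induction y rule: dec_induct) auto
    then have "T y - T x = (\<Sum>n=Suc x..<Suc y. c n * of_real (g n))" by simp
    also have "norm \<dots> \<le> D * g (Suc x)"
      by (rule abel_sum_bound) (use D dec pos in auto)
    finally show ?thesis .
  qed
  have "Cauchy T"
  proof (rule metric_CauchyI)
    fix e :: real assume e: "e > 0"
    have "(\<lambda>x. D * g (Suc x)) \<longlonglongrightarrow> D * 0"
      by (intro tendsto_mult_left) (use lim LIMSEQ_Suc in blast)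
    then have "eventually (\<lambda>x. D * g (Suc x) < e) sequentially"
      using e by (intro order_tendstoD(2)) auto
    then obtain M where M: "\<And>x. x \<ge> M \<Longrightarrow> D * g (Suc x) < e"
      by (auto simp: eventually_sequentially)
    have "dist (T x) (T y) < e" if "x \<ge> M" "y \<ge> M" for x y
    proof (cases "x \<le> y")
      case True
      then show ?thesis using diff[of x y] M[of x] that by (simp add: dist_norm norm_minus_commute)
    next
      case False
      then show ?thesis using diff[of y x] M[of y] that by (simp add: dist_norm)
    qed
    then show "\<exists>M. \<forall>x\<ge>M. \<forall>y\<ge>M. dist (T x) (T y) < e" by blast
  qed
  then obtain L where L: "T \<longlonglongrightarrow> L" using Cauchy_convergent convergent_def by blast
  have "norm (T x - L) \<le> D * g (Suc x)" for x
  proof (rule LIMSEQ_le_const2)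
    show "(\<lambda>y. norm (T x - T y)) \<longlonglongrightarrow> norm (T x - L)" by (intro tendsto_intros L)
    show "\<exists>M. \<forall>y\<ge>M. norm (T x - T y) \<le> D * g (Suc x)"
      using diff by (metis norm_minus_commute)
  qed
  then show ?thesis using that L unfolding T_def by blast
qed

section \<open>Sums of characters against the von Mangoldt function\<close>

text \<open>The sum is \<open>x ln x - ln (x!)\<close>, so this is the elementary half of Stirling's
  formula; a step of the induction adds \<open>x * ln (1 + 1 / x) \<le> 1\<close>.\<close>

lemma sum_ln_div_le: "(\<Sum>d=1..x. ln (real x / real d)) \<le> real x"
proof (induction x)
  case (Suc x)
  show ?case
  proof (cases "x = 0")
    case False
    have "(\<Sum>d=1..Suc x. ln (real (Suc x) / real d)) = (\<Sum>d=1..x. ln (real (Suc x) / real d))"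
      by simp
    also have "\<dots> = (\<Sum>d=1..x. ln (real x / real d) + ln (real (Suc x) / real x))"
      using False by (intro sum.cong) (auto simp: ln_div simp del: of_nat_Suc)
    also have "\<dots> = (\<Sum>d=1..x. ln (real x / real d)) + real x * ln (1 + 1 / real x)"
      using False by (simp add: sum.distrib field_simps)
    also have "\<dots> \<le> real x + real x * (1 / real x)"
      by (intro add_mono Suc mult_left_mono ln_add_one_self_le_self) auto
    finally show ?thesis using False by simp
  qed simp
qed simp

text \<open>The summand 1 makes the quotient decrease from 1 onwards; \<open>ln v / v\<close> does
  so only from \<open>exp 1\<close> on.\<close>

lemma one_plus_ln_div_antimono:
  assumes "1 \<le> u" "u \<le> (v::real)"
  shows "(1 + ln v) / v \<le> (1 + ln u) / u"
proof -
  have "u * ln (v / u) \<le> u * (v / u - 1)"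
    using assms by (intro mult_left_mono ln_le_minus_one) auto
  then have "u * ln v \<le> u * ln u + v - u" using assms by (simp add: ln_div algebra_simps)
  moreover have "u * ln u \<le> v * ln u" using assms by (intro mult_right_mono) auto
  ultimately have "u * (1 + ln v) \<le> v * (1 + ln u)" by (simp add: algebra_simps)
  then show ?thesis using assms by (simp add: divide_simps mult.commute)
qed

text \<open>An error of order \<open>1 / Suc (x div d)\<close>, weighted by \<open>1 / d\<close>, is
  thus of order \<open>1 / x\<close>, and the errors for all \<open>d \<le> x\<close> add up to a
  constant.\<close>

lemma inverse_Suc_div_le:
  assumes "1 \<le> d" "1 \<le> x"
  shows "1 / real d * (1 / real (Suc (x div d))) \<le> 1 / real x"
proof -
  have "x \<le> d * Suc (x div d)" using assms dividend_less_times_div[of d x] by simp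
  then have "real x \<le> real d * real (Suc (x div d))" by (metis of_nat_le_iff of_nat_mult)
  then show ?thesis using assms by (simp add: divide_simps del: of_nat_Suc)
qed

text \<open>The terms are regrouped by \<open>n = d * m\<close>, using complete multiplicativity.
  The weight \<open>g\<close> may depend on both factors; it is used with the values 1,
  \<open>ln m\<close> and \<open>ln (x / d)\<close>.\<close>

lemma sum_moebius_char_swap:
  fixes g :: "nat \<Rightarrow> nat \<Rightarrow> complex"
  assumes \<chi>: "\<chi> \<in> dirichlet_chars N"
  shows "(\<Sum>d=1..x. moebius_mu d * \<chi> d / of_nat d * (\<Sum>m=1..x div d. \<chi> m / of_nat m * g d m)) =
    (\<Sum>n=1..x. \<chi> n / of_nat n * (\<Sum>d | d dvd n. moebius_mu d * g d (n div d)))"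
proof -
  define f where "f d m = moebius_mu d * \<chi> (d * m) / of_nat (d * m) * g d m" for d m
  have "(\<Sum>d=1..x. moebius_mu d * \<chi> d / of_nat d * (\<Sum>m=1..x div d. \<chi> m / of_nat m * g d m)) =
      (\<Sum>d=1..x. \<Sum>m=1..x div d. f d m)"
    by (simp add: f_def sum_distrib_left dirichlet_charsD(2)[OF \<chi>] mult_ac)
  also have "\<dots> = (\<Sum>n=1..x. \<Sum>d | d dvd n. f d (n div d))"
    by (rule sum_divisors_swap[symmetric])
  also have "\<dots> = (\<Sum>n=1..x. \<chi> n / of_nat n * (\<Sum>d | d dvd n. moebius_mu d * g d (n div d)))"
    by (intro sum.cong refl) (auto simp: f_def sum_distrib_left mult_ac intro!: sum.cong)
  finally show ?thesis .
qed

section \<open>Finite sums attached to a character\<close>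

locale dirichlet_char =
  fixes N :: nat and \<chi> :: "nat \<Rightarrow> complex"
  assumes char: "\<chi> \<in> dirichlet_chars N" and N_pos: "N > 0"
begin

definition L_sum :: "nat \<Rightarrow> complex" where
  "L_sum x = (\<Sum>n=1..x. \<chi> n / of_nat n)"

definition mangoldt_sum_char :: "nat \<Rightarrow> complex" where
  "mangoldt_sum_char x = (\<Sum>n=1..x. \<chi> n / of_nat n * mangoldt n)"

text \<open>Formally a partial sum of the series for \<open>1 / L(1, \<chi>)\<close>.\<close>

definition moebius_sum :: "nat \<Rightarrow> complex" where
  "moebius_sum x = (\<Sum>d=1..x. moebius_mu d * \<chi> d / of_nat d)"

lemma norm_moebius_term_le: "norm (moebius_mu d * \<chi> d / of_nat d) \<le> 1 / real d"
proof -
  have "norm (moebius_mu d :: complex) * norm (\<chi> d) \<le> 1 * 1"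
    by (intro mult_mono norm_moebius_le norm_dirichlet_char_le[OF char N_pos]) auto
  then show ?thesis by (simp add: norm_mult norm_divide divide_right_mono)
qed

lemma sum_moebius_diff:
  "(\<Sum>d=1..x. moebius_mu d * \<chi> d / of_nat d * (F d - L)) =
    (\<Sum>d=1..x. moebius_mu d * \<chi> d / of_nat d * F d) - L * moebius_sum x"
  by (simp only: moebius_sum_def right_diff_distrib sum_subtractf sum_distrib_right mult.commute[of L])

text \<open>Finite form of the product of \<open>L(1, \<chi>)\<close> with its inverse
  series.\<close>

lemma sum_moebius_L_sum:
  assumes "x \<ge> 1"
  shows "(\<Sum>d=1..x. moebius_mu d * \<chi> d / of_nat d * L_sum (x div d)) = 1"
proof -
  have "(\<Sum>d=1..x. moebius_mu d * \<chi> d / of_nat d * L_sum (x div d)) =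
      (\<Sum>n=1..x. \<chi> n / of_nat n * (\<Sum>d | d dvd n. moebius_mu d))"
    using sum_moebius_char_swap[OF char, where g = "\<lambda>_ _. 1" and x = x] by (simp add: L_sum_def)
  also have "\<dots> = (\<Sum>n=1..x. if n = 1 then 1 else 0)"
    by (intro sum.cong refl) (auto simp: sum_divisors_moebius dirichlet_charsD(1)[OF char, simplified])
  finally show ?thesis using assms by (simp add: sum.delta)
qed

lemma sum_moebius_ln_char:
  "(\<Sum>d=1..x. moebius_mu d * \<chi> d / of_nat d * (\<Sum>m=1..x div d. \<chi> m / of_nat m * of_real (ln (real m)))) =
    mangoldt_sum_char x"
  unfolding sum_moebius_char_swap[OF char] mangoldt_sum_char_def
  by (intro sum.cong refl) (simp add: sum_moebius_ln)

text \<open>With \<open>n = d * m\<close>, the weight is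
  \<open>ln (x / d) = ln (x / n) + ln (n / d)\<close>. The first part survives only at
  \<open>n = 1\<close>, where it gives \<open>ln x\<close>; the second gives the von Mangoldt
  function.\<close>

lemma sum_moebius_ln_L_sum:
  assumes "x \<ge> 1"
  shows "(\<Sum>d=1..x. moebius_mu d * \<chi> d / of_nat d * (of_real (ln (real x / real d)) * L_sum (x div d))) =
    of_real (ln (real x)) + mangoldt_sum_char x"
proof -
  have "(\<Sum>d=1..x. moebius_mu d * \<chi> d / of_nat d * (of_real (ln (real x / real d)) * L_sum (x div d))) =
      (\<Sum>n=1..x. \<chi> n / of_nat n * (\<Sum>d | d dvd n. moebius_mu d * of_real (ln (real x / real d))))"
    using sum_moebius_char_swap[OF char, where g = "\<lambda>d _. of_real (ln (real x / real d))" and x = x]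
    by (simp add: L_sum_def sum_distrib_left mult_ac)
  also have "\<dots> = (\<Sum>n=1..x. (if n = 1 then of_real (ln (real x)) else 0) + \<chi> n / of_nat n * mangoldt n)"
  proof (intro sum.cong refl)
    fix n assume n: "n \<in> {1..x}"
    have "(\<Sum>d | d dvd n. moebius_mu d * of_real (ln (real x / real d))) =
        (\<Sum>d | d dvd n. of_real (ln (real x / real n)) * moebius_mu d
           + moebius_mu d * (of_real (ln (real (n div d))) :: complex))"
    proof (intro sum.cong refl)
      fix d assume "d \<in> {d. d dvd n}"
      then have d: "d dvd n" "d > 0" using n by (auto intro: Nat.gr0I)
      then have "ln (real x / real d) = ln (real x / real n) + ln (real (n div d))"
        using n by (simp add: real_of_nat_div ln_div)
      then show "moebius_mu d * of_real (ln (real x / real d)) =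
        of_real (ln (real x / real n)) * moebius_mu d + moebius_mu d * (of_real (ln (real (n div d))) :: complex)"
        by (simp add: algebra_simps)
    qed
    also have "\<dots> = of_real (ln (real x / real n)) * (if n = 1 then 1 else 0) + mangoldt n"
      using n by (simp add: sum.distrib sum_distrib_left[symmetric] sum_divisors_moebius sum_moebius_ln)
    finally show "\<chi> n / of_nat n * (\<Sum>d | d dvd n. moebius_mu d * of_real (ln (real x / real d))) =
        (if n = 1 then of_real (ln (real x)) else 0) + \<chi> n / of_nat n * mangoldt n"
      using dirichlet_charsD(1)[OF char] by (simp add: algebra_simps)
  qed
  also have "\<dots> = of_real (ln (real x)) + mangoldt_sum_char x"
    using assms by (simp add: sum.distrib sum.delta mangoldt_sum_char_def)
  finally show ?thesis .
qed

end

locale nonprincipal_dirichlet_char = dirichlet_char +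
  assumes nonprincipal: "\<exists>a. coprime a N \<and> \<chi> a \<noteq> 1"
begin

lemma norm_char_interval_sum_le: "norm (\<Sum>n=m..<k. \<chi> n) \<le> 2 * real N"
proof (cases "m \<le> k")
  case True
  obtain a where a: "coprime a N" "\<chi> a \<noteq> 1" using nonprincipal by blast
  have "(\<Sum>n=m..<k. \<chi> n) = (\<Sum>n<k. \<chi> n) - (\<Sum>n<m. \<chi> n)"
    using sum_diff_nat_ivl[of 0 m k \<chi>] True by (simp add: lessThan_atLeast0)
  also have "norm \<dots> \<le> real N + real N"
    using norm_dirichlet_char_sum_le[OF char N_pos a]
    by (intro norm_triangle_le_diff add_mono) auto
  finally show ?thesis by simp
qed simp

text \<open>This is \<open>L(1, \<chi>)\<close>; convergence of the partial sums is part of the next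
  lemma.\<close>

definition L1 :: complex where "L1 = lim L_sum"

lemma
  shows L_sum_tendsto: "L_sum \<longlonglongrightarrow> L1"
    and norm_L_sum_diff: "norm (L_sum x - L1) \<le> 2 * real N * (1 / real (Suc x))"
proof -
  obtain L where *: "\<And>x. norm ((\<Sum>n=1..x. \<chi> n * of_real (1 / real n)) - L) \<le> 2 * real N * (1 / real (Suc x))"
    "(\<lambda>x. \<Sum>n=1..x. \<chi> n * of_real (1 / real n)) \<longlonglongrightarrow> L"
    by (rule abel_sum_converges[of \<chi> "2 * real N" "\<lambda>n. 1 / real n"])
      (use norm_char_interval_sum_le lim_1_over_n in \<open>auto simp: divide_simps\<close>)
  have eq: "L_sum = (\<lambda>x. \<Sum>n=1..x. \<chi> n * of_real (1 / real n))"
    by (auto simp: L_sum_def)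
  have lim: "L_sum \<longlonglongrightarrow> L" using *(2) unfolding eq .
  then have "L = L1" unfolding L1_def by (simp add: limI)
  then show "L_sum \<longlonglongrightarrow> L1" "norm (L_sum x - L1) \<le> 2 * real N * (1 / real (Suc x))"
    using lim *(1) unfolding eq by auto
qed

text \<open>In \<open>sum_moebius_L_sum\<close> each \<open>L_sum (x div d)\<close> is replaced by
  its limit; the errors add up to at most \<open>2 * N\<close>.\<close>

lemma norm_moebius_sum_le:
  assumes "x \<ge> 1"
  shows "norm (L1 * moebius_sum x) \<le> 1 + 2 * real N"
proof -
  have "L1 * moebius_sum x = 1 - (\<Sum>d=1..x. moebius_mu d * \<chi> d / of_nat d * (L_sum (x div d) - L1))"
    unfolding sum_moebius_diff sum_moebius_L_sum[OF assms] by simp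
  also have "norm \<dots> \<le> norm (1::complex) + (\<Sum>d=1..x. 2 * real N * (1 / real x))"
  proof (intro norm_triangle_le_diff add_mono order_refl sum_norm_le)
    fix d assume d: "d \<in> {1..x}"
    have "norm (moebius_mu d * \<chi> d / of_nat d * (L_sum (x div d) - L1)) \<le>
        1 / real d * (2 * real N * (1 / real (Suc (x div d))))"
      unfolding norm_mult[of "_ / _"]
      by (intro mult_mono norm_moebius_term_le norm_L_sum_diff) auto
    also have "\<dots> = 2 * real N * (1 / real d * (1 / real (Suc (x div d))))" by simp
    also have "\<dots> \<le> 2 * real N * (1 / real x)"
      using d assms by (intro mult_left_mono inverse_Suc_div_le) auto
    finally show "norm (moebius_mu d * \<chi> d / of_nat d * (L_sum (x div d) - L1)) \<le> 2 * real N * (1 / real x)" .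
  qed
  also have "\<dots> = 1 + 2 * real N" using assms by simp
  finally show ?thesis .
qed

text \<open>Replacing the inner sums of \<open>\<chi> m * (1 + ln m) / m\<close> by their limit
  \<open>L\<close> leaves \<open>L * moebius_sum x\<close>, which \<open>norm_moebius_sum_le\<close>
  bounds because \<open>L1 \<noteq> 0\<close>.\<close>

lemma mangoldt_sum_char_bounded:
  assumes "L1 \<noteq> 0"
  shows "\<exists>K. \<forall>x\<ge>1. norm (mangoldt_sum_char x) \<le> K"
proof -
  \<comment> \<open>\<open>ln n / n\<close> is not monotone at the start, so Abel summation is
    applied with \<open>1 + ln n\<close>; the additional \<open>L_sum\<close> contributes 1, which
    is subtracted again.\<close>
  define g where "g n = (1 + ln (real n)) / real n" for n
  have "g \<longlonglongrightarrow> 0" unfolding g_def by real_asymp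
  then obtain L where L: "\<And>x. norm ((\<Sum>n=1..x. \<chi> n * of_real (g n)) - L) \<le> 2 * real N * g (Suc x)"
    by (rule abel_sum_converges[of \<chi> "2 * real N" g, rotated 2])
      (use norm_char_interval_sum_le in \<open>auto simp: g_def intro!: one_plus_ln_div_antimono\<close>)
  define C where "C x = (\<Sum>n=1..x. \<chi> n * of_real (g n))" for x
  have "norm (mangoldt_sum_char x) \<le> norm L * ((1 + 2 * real N) / norm L1) + 4 * real N + 1" if x: "x \<ge> 1" for x
  proof -
    have "C y = (\<Sum>m=1..y. \<chi> m / of_nat m * of_real (ln (real m))) + L_sum y" for y
      unfolding C_def L_sum_def sum.distrib[symmetric]
      by (intro sum.cong) (auto simp: g_def field_simps)
    then have *: "(\<Sum>d=1..x. moebius_mu d * \<chi> d / of_nat d * C (x div d)) = mangoldt_sum_char x + 1"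
      using sum_moebius_ln_char[of x] sum_moebius_L_sum[OF x]
      by (simp only: distrib_left sum.distrib)
    have "mangoldt_sum_char x =
        L * moebius_sum x + (\<Sum>d=1..x. moebius_mu d * \<chi> d / of_nat d * (C (x div d) - L)) - 1"
      unfolding sum_moebius_diff * by simp
    also have "norm \<dots> \<le> norm L * ((1 + 2 * real N) / norm L1) + 4 * real N + norm (1::complex)"
    proof (intro norm_triangle_le_diff norm_triangle_le add_mono order_refl)
      have "norm (moebius_sum x) \<le> (1 + 2 * real N) / norm L1"
        using norm_moebius_sum_le[OF x] assms by (simp add: norm_mult pos_le_divide_eq mult.commute)
      then show "norm (L * moebius_sum x) \<le> norm L * ((1 + 2 * real N) / norm L1)"
        unfolding norm_mult by (rule mult_left_mono) simp
      have "norm (\<Sum>d=1..x. moebius_mu d * \<chi> d / of_nat d * (C (x div d) - L)) \<le>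
          (\<Sum>d=1..x. 2 * real N * (1 / real x) * (1 + ln (real x / real d)))"
      proof (rule sum_norm_le)
        fix d assume d: "d \<in> {1..x}"
        have "real x \<le> real d * real (Suc (x div d))"
          using d dividend_less_times_div[of d x] by (metis atLeastAtMost_iff less_imp_le mult_Suc_right
            not_one_le_zero of_nat_le_iff of_nat_mult gr0I)
        then have le: "real x / real d \<le> real (Suc (x div d))"
          using d by (simp add: divide_simps mult.commute del: of_nat_Suc)
        have "norm (moebius_mu d * \<chi> d / of_nat d * (C (x div d) - L)) \<le>
            1 / real d * (2 * real N * g (Suc (x div d)))"
          unfolding norm_mult[of "_ / _"] C_def
          by (intro mult_mono norm_moebius_term_le L) auto
        also have "\<dots> \<le> 1 / real d * (2 * real N * ((1 + ln (real x / real d)) / (real x / real d)))"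
          unfolding g_def using d le by (intro mult_left_mono one_plus_ln_div_antimono) auto
        also have "\<dots> = 2 * real N * (1 / real x) * (1 + ln (real x / real d))"
          using d by (simp add: field_simps)
        finally show "norm (moebius_mu d * \<chi> d / of_nat d * (C (x div d) - L)) \<le>
            2 * real N * (1 / real x) * (1 + ln (real x / real d))" .
      qed
      also have "\<dots> = 2 * real N * (1 / real x) * (real x + (\<Sum>d=1..x. ln (real x / real d)))"
        unfolding sum_distrib_left[symmetric] sum.distrib by simp
      also have "\<dots> \<le> 2 * real N * (1 / real x) * (real x + real x)"
        by (intro mult_left_mono add_left_mono sum_ln_div_le) auto
      also have "\<dots> = 4 * real N" using x by simp
      finally show "norm (\<Sum>d=1..x. moebius_mu d * \<chi> d / of_nat d * (C (x div d) - L)) \<le> 4 * real N" .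
    qed
    finally show ?thesis by simp
  qed
  then show ?thesis by blast
qed

text \<open>With limit 0, \<open>L_sum (x div d)\<close> is itself of order \<open>d / x\<close>.
  The remaining factors \<open>ln (x / d)\<close> have sum at most \<open>x\<close>, which
  compensates the \<open>1 / x\<close>.\<close>

lemma mangoldt_sum_char_plus_ln_bounded:
  assumes "L1 = 0" "x \<ge> 1"
  shows "norm (of_real (ln (real x)) + mangoldt_sum_char x) \<le> 2 * real N"
proof -
  have "norm (of_real (ln (real x)) + mangoldt_sum_char x) \<le>
      (\<Sum>d=1..x. 2 * real N * (1 / real x) * ln (real x / real d))"
    unfolding sum_moebius_ln_L_sum[OF assms(2), symmetric]
  proof (rule sum_norm_le)
    fix d assume d: "d \<in> {1..x}"
    have ln0: "ln (real x / real d) \<ge> 0" using d by simp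
    have "norm (L_sum (x div d)) \<le> 2 * real N * (1 / real (Suc (x div d)))"
      using norm_L_sum_diff[of "x div d"] assms by simp
    then have "norm (moebius_mu d * \<chi> d / of_nat d * (of_real (ln (real x / real d)) * L_sum (x div d))) \<le>
        1 / real d * (ln (real x / real d) * (2 * real N * (1 / real (Suc (x div d)))))"
      unfolding norm_mult[of "_ / _"] norm_mult[of "of_real _"] norm_of_real abs_of_nonneg[OF ln0]
      using ln0 by (intro mult_mono norm_moebius_term_le) auto
    also have "\<dots> = 2 * real N * ln (real x / real d) * (1 / real d * (1 / real (Suc (x div d))))"
      by simp
    also have "\<dots> \<le> 2 * real N * ln (real x / real d) * (1 / real x)"
      using d assms ln0 by (intro mult_left_mono inverse_Suc_div_le) auto
    finally show "norm (moebius_mu d * \<chi> d / of_nat d * (of_real (ln (real x / real d)) * L_sum (x div d))) \<le>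
        2 * real N * (1 / real x) * ln (real x / real d)" by (simp add: mult_ac)
  qed
  also have "\<dots> \<le> 2 * real N * (1 / real x) * real x"
    unfolding sum_distrib_left[symmetric] by (intro mult_left_mono sum_ln_div_le) auto
  finally show ?thesis using assms by simp
qed

end

section \<open>Nonvanishing for real characters\<close>

text \<open>One Euler factor is split off: the divisors are uniquely \<open>p ^ i * d\<close> with
  \<open>i \<le> k\<close> and \<open>d\<close> dividing \<open>m\<close>.\<close>

lemma sum_divisors_prime_power_times:
  fixes f :: "nat \<Rightarrow> 'a :: comm_semiring_1"
  assumes "prime p" "\<not> p dvd m" and mult: "\<And>a b. f (a * b) = f a * f b" and f1: "f 1 = 1"
  shows "(\<Sum>d | d dvd p ^ k * m. f d) = (\<Sum>i\<le>k. f p ^ i) * (\<Sum>d | d dvd m. f d)"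
proof -
  have m: "m \<noteq> 0" using assms(2) by (metis dvd_0_right)
  have pow: "f (p ^ i) = f p ^ i" for i
    by (induction i) (use mult f1 in auto)
  have "bij_betw (\<lambda>(i, d). p ^ i * d) ({..k} \<times> {d. d dvd m}) {d. d dvd p ^ k * m}"
    unfolding bij_betw_def
  proof
    have mul: "multiplicity p (p ^ i * d) = i" if "d dvd m" for i d
    proof -
      have "\<not> p dvd d" "d \<noteq> 0" using that assms(2) m dvd_trans by auto
      then show ?thesis using assms(1)
        by (simp add: prime_elem_multiplicity_mult_distrib not_dvd_imp_multiplicity_0 prime_imp_prime_elem)
    qed
    show "inj_on (\<lambda>(i, d). p ^ i * d) ({..k} \<times> {d. d dvd m})"
    proof (rule inj_onI, clarify)
      fix i d j e assume *: "d dvd m" "e dvd m" "p ^ i * d = p ^ j * e"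
      then have "i = j" using mul by metis
      then show "i = j \<and> d = e" using * assms(1) by (simp add: prime_gt_0_nat)
    qed
    show "(\<lambda>(i, d). p ^ i * d) ` ({..k} \<times> {d. d dvd m}) = {d. d dvd p ^ k * m}"
    proof (intro equalityI subsetI)
      fix d assume "d \<in> {d. d dvd p ^ k * m}"
      then obtain b c where bc: "d = b * c" "b dvd p ^ k" "c dvd m"
        using division_decomp[of d "p ^ k" m] by auto
      then obtain i where "i \<le> k" "b = p ^ i" using divides_primepow_nat[OF assms(1)] by blast
      then show "d \<in> (\<lambda>(i, d). p ^ i * d) ` ({..k} \<times> {d. d dvd m})" using bc by force
    qed (auto intro!: mult_dvd_mono le_imp_power_dvd)
  qed
  then have "(\<Sum>d | d dvd p ^ k * m. f d) = (\<Sum>(i, d)\<in>{..k} \<times> {d. d dvd m}. f (p ^ i * d))"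
    by (subst sum.reindex_bij_betw[symmetric]) (auto simp: case_prod_unfold)
  also have "\<dots> = (\<Sum>i\<le>k. \<Sum>d | d dvd m. f p ^ i * f d)"
    using m by (subst sum.cartesian_product) (simp add: mult pow)
  also have "\<dots> = (\<Sum>i\<le>k. f p ^ i) * (\<Sum>d | d dvd m. f d)"
    by (simp add: sum_product)
  finally show ?thesis .
qed

text \<open>Each prime contributes a geometric sum with ratio -1, 0 or 1, which is nonnegative, and
  at least 1 when the exponent is even. The second claim is meant for squares.\<close>

lemma sum_divisors_real_char_nonneg:
  fixes f :: "nat \<Rightarrow> real"
  assumes mult: "\<And>a b. f (a * b) = f a * f b" and f1: "f 1 = 1" and vals: "\<And>a. f a \<in> {-1, 0, 1}"
    and "m > 0"
  shows "(\<Sum>d | d dvd m. f d) \<ge> 0 \<and>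
    ((\<forall>p. prime p \<longrightarrow> even (multiplicity p m)) \<longrightarrow> (\<Sum>d | d dvd m. f d) \<ge> 1)"
  using \<open>m > 0\<close>
proof (induction m rule: less_induct)
  case (less m)
  show ?case
  proof (cases "m = 1")
    case True
    then show ?thesis using f1 by simp
  next
    case False
    then obtain p where p: "prime p" "p dvd m" using prime_factor_nat by blast
    define k where "k = multiplicity p m"
    have "m \<noteq> 0" "\<not> is_unit p" using less.prems p(1) by auto
    then obtain m' where m': "m = p ^ k * m'" "\<not> p dvd m'"
      unfolding k_def by (rule multiplicity_decompose')
    have m'0: "m' > 0" using m'(2) by (intro Nat.gr0I) auto
    have "k > 0" using p \<open>m \<noteq> 0\<close> by (simp add: k_def prime_multiplicity_gt_zero_iff)
    then have "1 < p ^ k" using prime_gt_1_nat[OF p(1)] by (rule one_less_power[rotated])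
    then have "m' < m" using m'0 unfolding m'(1) by simp
    note IH = less.IH[OF this m'0]
    have geo: "(\<Sum>i\<le>k. f p ^ i) \<ge> 0 \<and> (even k \<longrightarrow> (\<Sum>i\<le>k. f p ^ i) \<ge> 1)"
    proof -
      have "(\<Sum>i\<le>k. (-1::real) ^ i) = (if even k then 1 else 0)" for k
        by (induction k) auto
      moreover have "(\<Sum>i\<le>k. (0::real) ^ i) = 1" for k
        by (induction k) auto
      ultimately show ?thesis using vals[of p] by auto
    qed
    have eq: "(\<Sum>d | d dvd m. f d) = (\<Sum>i\<le>k. f p ^ i) * (\<Sum>d | d dvd m'. f d)"
      unfolding m'(1) by (rule sum_divisors_prime_power_times[OF p(1) m'(2) mult f1])
    have "(\<Sum>d | d dvd m. f d) \<ge> 1" if ev: "\<forall>q. prime q \<longrightarrow> even (multiplicity q m)"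
    proof -
      have "even (multiplicity q m')" if q: "prime q" for q
      proof (cases "q = p")
        case True
        then show ?thesis using m'(2) by (simp add: not_dvd_imp_multiplicity_0)
      next
        case False
        then have "multiplicity q m = multiplicity q m'"
          unfolding m'(1) using p(1) q m'0
          by (subst prime_elem_multiplicity_mult_distrib)
            (auto simp: prime_imp_prime_elem multiplicity_distinct_prime_power prime_gt_0_nat)
        then show ?thesis using ev q by metis
      qed
      then have "(\<Sum>d | d dvd m'. f d) \<ge> 1" using IH by blast
      moreover have "even k" using ev p(1) by (simp add: k_def)
      ultimately have "1 * 1 \<le> (\<Sum>i\<le>k. f p ^ i) * (\<Sum>d | d dvd m'. f d)"
        using geo by (intro mult_mono) auto
      then show ?thesis unfolding eq by simp
    qed
    then show ?thesis using IH geo unfolding eq by (auto intro: mult_nonneg_nonneg)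
  qed
qed

text \<open>The terms with index \<open>i\<close> and \<open>n - 1 - i\<close> are paired and
  estimated by \<open>x ^ 2 + y ^ 2 \<ge> 2 * x * y\<close>.\<close>

lemma geometric_sum_ge:
  assumes "0 < r" "r \<le> (1::real)"
  shows "real n * r ^ (n - 1) \<le> (\<Sum>i<n. (r ^ 2) ^ i)"
proof -
  have sq: "(r ^ 2) ^ i = (r ^ i) ^ 2" for i by (simp flip: power_mult add: mult.commute)
  have "2 * (\<Sum>i<n. (r ^ 2) ^ i) = (\<Sum>i<n. (r ^ 2) ^ i) + (\<Sum>i<n. (r ^ 2) ^ (n - Suc i))"
    using sum.nat_diff_reindex[of "\<lambda>i. (r ^ 2) ^ i" n] by simp
  also have "\<dots> = (\<Sum>i<n. (r ^ 2) ^ i + (r ^ 2) ^ (n - Suc i))" by (rule sum.distrib[symmetric])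
  also have "\<dots> \<ge> (\<Sum>i<n. 2 * r ^ (n - 1))"
  proof (rule sum_mono)
    fix i assume "i \<in> {..<n}"
    then have "r ^ (n - 1) = r ^ i * r ^ (n - Suc i)" by (simp flip: power_add)
    then show "2 * r ^ (n - 1) \<le> (r ^ 2) ^ i + (r ^ 2) ^ (n - Suc i)"
      using sum_squares_bound[of "r ^ i" "r ^ (n - Suc i)"] sq by (simp add: mult.assoc)
  qed
  finally show ?thesis by simp
qed

text \<open>The Lambert term \<open>t ^ n / (1 - t ^ n)\<close> is subtracted from its pole at
  \<open>t = 1\<close>. Summed against a character, the first term gives
  \<open>L(1, \<chi>) / (1 - t)\<close>, so for vanishing \<open>L1\<close> only the Lambert series
  remains, up to sign.\<close>

definition lambert_weight :: "real \<Rightarrow> nat \<Rightarrow> real" where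
  "lambert_weight t n = 1 / (real n * (1 - t)) - t ^ n / (1 - t ^ n)"

text \<open>With \<open>s n\<close> the geometric sum, the decrease amounts to
  \<open>n * (n + 1) * t ^ n \<le> s n * s (n + 1)\<close>, which follows from
  \<open>geometric_sum_ge\<close>. The form \<open>t = r ^ 2\<close> provides the square root that
  this estimate needs.\<close>

lemma lambert_weight_props:
  assumes r: "0 < r" "r < 1" and n: "n \<ge> 1"
  shows "lambert_weight (r ^ 2) (Suc n) \<le> lambert_weight (r ^ 2) n"
    and "lambert_weight (r ^ 2) n \<ge> 0"
proof -
  define t where "t = r ^ 2"
  have t: "0 < t" "t < 1" using r by (auto simp: t_def power_less_one_iff)
  define s where "s n = (\<Sum>i<n. t ^ i)" for n
  have s: "1 - t ^ n = (1 - t) * s n" for n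
    using one_diff_power_eq[of t n] by (simp add: s_def)
  have spos: "s n > 0" if "n \<ge> 1" for n
    unfolding s_def using t that by (intro sum_pos) (auto simp: lessThan_empty_iff)
  have "real n * r ^ (n - 1) * (real (Suc n) * r ^ n) \<le> s n * s (Suc n)"
    unfolding s_def t_def using r geometric_sum_ge[of r n] geometric_sum_ge[of r "Suc n"]
    by (intro mult_mono) (auto intro: sum_nonneg)
  moreover have "t ^ n \<le> r ^ (n - 1) * r ^ n"
    unfolding t_def power_mult[symmetric] power_add[symmetric] using r n by (intro power_decreasing) auto
  then have "real n * real (Suc n) * t ^ n \<le> real n * real (Suc n) * (r ^ (n - 1) * r ^ n)"
    by (intro mult_left_mono) auto
  ultimately have key: "real n * real (Suc n) * t ^ n \<le> s n * s (Suc n)" by (simp add: mult_ac)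
  have "t ^ n / (1 - t ^ n) - t ^ Suc n / (1 - t ^ Suc n) =
      (t ^ n * (1 - t ^ Suc n) - t ^ Suc n * (1 - t ^ n)) / ((1 - t ^ n) * (1 - t ^ Suc n))"
    unfolding s using spos[of n] spos[of "Suc n"] t n by (subst diff_frac_eq) auto
  also have "t ^ n * (1 - t ^ Suc n) - t ^ Suc n * (1 - t ^ n) = t ^ n * (1 - t)"
    by (simp add: algebra_simps)
  also have "t ^ n * (1 - t) / ((1 - t ^ n) * (1 - t ^ Suc n)) = t ^ n / (s n * s (Suc n)) / (1 - t)"
  proof -
    have "x * c / ((c * y) * (c * z)) = x / (y * z) / c" if "c \<noteq> 0" "y \<noteq> 0" "z \<noteq> 0" for x c y z :: real
      using that by (simp add: field_simps)
    then show ?thesis unfolding s using t spos[of n] spos[of "Suc n"] n by simp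
  qed
  also have "\<dots> \<le> 1 / (real n * real (Suc n)) / (1 - t)"
    using key spos[of n] spos[of "Suc n"] t n
    by (intro divide_right_mono) (simp_all add: divide_simps mult_ac del: of_nat_Suc)
  also have "\<dots> = 1 / (real n * (1 - t)) - 1 / (real (Suc n) * (1 - t))"
  proof -
    have "1 / (real n * real (Suc n)) = 1 / real n - 1 / real (Suc n)" using n by (simp add: field_simps)
    then show ?thesis by (simp add: diff_divide_distrib)
  qed
  finally show "lambert_weight (r ^ 2) (Suc n) \<le> lambert_weight (r ^ 2) n"
    unfolding lambert_weight_def t_def[symmetric] by simp
  have "real n * t ^ n \<le> s n"
    unfolding s_def using sum_bounded_below[of "{..<n}" "t ^ n" "\<lambda>i. t ^ i"] t
    by (simp add: power_decreasing)
  then have "t ^ n / s n / (1 - t) \<le> 1 / real n / (1 - t)"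
    using spos[OF n] n t by (intro divide_right_mono) (auto simp: divide_simps mult.commute)
  then show "lambert_weight (r ^ 2) n \<ge> 0"
    unfolding lambert_weight_def t_def[symmetric] s by (simp add: mult.commute)
qed


context nonprincipal_dirichlet_char
begin

text \<open>
  If \<open>L1 = 0\<close>, then the Lambert series of a real \<open>\<chi>\<close> is minus the sum of the \<open>\<chi> n\<close> against the
  decreasing weights \<^const>\<open>lambert_weight\<close>, hence bounded as \<open>t\<close> tends to 1. But its coefficients
  are the nonnegative divisor sums of \<open>\<chi>\<close>, which are at least 1 at the squares.
\<close>
lemma L1_nonzero_if_real:
  assumes real: "\<And>n. cnj (\<chi> n) = \<chi> n"
  shows "L1 \<noteq> 0"
proof
  assume L1: "L1 = 0"
  define f where "f n = Re (\<chi> n)" for n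
  have \<chi>f: "\<chi> n = of_real (f n)" for n
    using real[of n] unfolding f_def by (simp add: complex_eq_iff)
  have f1: "f 1 = 1" using dirichlet_charsD(1)[OF char] by (simp add: f_def)
  have fmult: "f (m * n) = f m * f n" for m n
  proof -
    have "complex_of_real (f (m * n)) = of_real (f m * f n)"
      using dirichlet_charsD(2)[OF char, of m n] unfolding \<chi>f by simp
    then show ?thesis by (simp only: of_real_eq_iff)
  qed
  have fvals: "f n \<in> {-1, 0, 1}" for n
  proof (cases "coprime n N")
    case True
    then have "\<bar>f n\<bar> = 1" using norm_dirichlet_char[OF char N_pos True] unfolding \<chi>f by simp
    then show ?thesis by auto
  next
    case False
    then show ?thesis using dirichlet_charsD(4)[OF char, of n] unfolding \<chi>f by simp
  qed
  have fabs: "\<bar>f n\<bar> \<le> 1" for n using fvals[of n] by auto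
  define \<rho> where "\<rho> m = (\<Sum>d | d dvd m. f d)" for m
  have \<rho>: "\<rho> m \<ge> 0" "(\<And>p. prime p \<Longrightarrow> even (multiplicity p m)) \<Longrightarrow> \<rho> m \<ge> 1" if "m > 0" for m
    using sum_divisors_real_char_nonneg[OF fmult f1 fvals that] unfolding \<rho>_def by auto
  have \<rho>sq: "\<rho> (j ^ 2) \<ge> 1" if "j > 0" for j
    using that by (intro \<rho>) (auto simp: prime_elem_multiplicity_power_distrib prime_imp_prime_elem)

  have bound: "(\<Sum>j=1..M. (r ^ 2) ^ (j ^ 2)) \<le> 2 * real N" if r: "0 < r" "r < 1" for r :: real and M
  proof -
    define t where "t = r ^ 2"
    have t: "0 < t" "t < 1" using r by (auto simp: t_def power_less_one_iff)
    \<comment> \<open>Truncation at \<open>K\<close>: the second term is the error of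
      \<open>L_sum K\<close> against the limit 0, the third collects the tails of the
      \<open>K\<close> geometric series. Both vanish as \<open>K\<close> grows, with
      \<open>t\<close> fixed.\<close>
    have main: "(\<Sum>j=1..M. t ^ (j ^ 2)) \<le> 2 * real N + 2 * real N / (1 - t) * (1 / real (Suc K)) + real K * t ^ K / (1 - t)"
      if K: "K \<ge> M ^ 2" for K
    proof -
      have "(\<Sum>j=1..M. t ^ (j ^ 2)) \<le> (\<Sum>j=1..M. t ^ (j ^ 2) * \<rho> (j ^ 2))"
        using t by (intro sum_mono) (simp add: \<rho>sq)
      also have "\<dots> = (\<Sum>m\<in>(\<lambda>j. j ^ 2) ` {1..M}. t ^ m * \<rho> m)"
        by (subst sum.reindex) (auto simp: inj_on_def)
      also have "\<dots> \<le> (\<Sum>m=1..K. t ^ m * \<rho> m)"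
      proof (rule sum_mono2)
        have "j ^ 2 \<le> K" if "j \<le> M" for j using that K power_mono[of j M 2] by linarith
        then show "(\<lambda>j. j ^ 2) ` {1..M} \<subseteq> {1..K}" by (auto simp: Suc_le_eq)
      qed (use t \<rho>(1) in auto)
      also have "\<dots> = (\<Sum>m=1..K. \<Sum>d | d dvd m. f d * t ^ (d * (m div d)))"
        by (intro sum.cong refl) (auto simp: \<rho>_def sum_distrib_left mult.commute intro!: sum.cong)
      also have "\<dots> = (\<Sum>n=1..K. \<Sum>k=1..K div n. f n * t ^ (n * k))"
        by (rule sum_divisors_swap)
      also have "\<dots> = (\<Sum>n=1..K. f n * (t ^ n / (1 - t ^ n)) - f n * (t ^ (n * Suc (K div n)) / (1 - t ^ n)))"
      proof (rule sum.cong[OF refl])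
        fix n assume n: "n \<in> {1..K}"
        have tn: "t ^ n < 1" using t n by (simp add: power_less_one_iff)
        have "(\<Sum>k=1..K div n. (t ^ n) ^ k) = (t ^ n - (t ^ n) ^ Suc (K div n)) / (1 - t ^ n)"
          using tn by (subst sum_gp) auto
        then show "(\<Sum>k=1..K div n. f n * t ^ (n * k)) =
            f n * (t ^ n / (1 - t ^ n)) - f n * (t ^ (n * Suc (K div n)) / (1 - t ^ n))"
          by (simp only: power_mult sum_distrib_left[symmetric] diff_divide_distrib right_diff_distrib)
      qed
      also have "\<dots> \<le> (\<Sum>n=1..K. f n * (t ^ n / (1 - t ^ n)) + t ^ K / (1 - t))"
      proof (rule sum_mono)
        fix n assume n: "n \<in> {1..K}"
        have tn: "t ^ n \<le> t" using t n power_decreasing[of 1 n t] by simp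
        have "K \<le> n * Suc (K div n)" using n dividend_less_times_div[of n K] by simp
        then have "t ^ (n * Suc (K div n)) / (1 - t ^ n) \<le> t ^ K / (1 - t)"
          using t tn by (intro frac_le power_decreasing) auto
        moreover have "t ^ (n * Suc (K div n)) / (1 - t ^ n) \<ge> 0" using t tn by simp
        then have "- f n * (t ^ (n * Suc (K div n)) / (1 - t ^ n)) \<le> 1 * (t ^ (n * Suc (K div n)) / (1 - t ^ n))"
          using fabs[of n] by (intro mult_right_mono) auto
        ultimately show "f n * (t ^ n / (1 - t ^ n)) - f n * (t ^ (n * Suc (K div n)) / (1 - t ^ n))
            \<le> f n * (t ^ n / (1 - t ^ n)) + t ^ K / (1 - t)" by simp
      qed
      also have "\<dots> = (\<Sum>n=1..K. f n * (t ^ n / (1 - t ^ n))) + real K * t ^ K / (1 - t)"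
        by (simp add: sum.distrib)
      also have "(\<Sum>n=1..K. f n * (t ^ n / (1 - t ^ n))) =
          (\<Sum>n=1..K. f n / real n) / (1 - t) - (\<Sum>n=1..K. f n * lambert_weight t n)"
        by (simp add: lambert_weight_def sum_divide_distrib sum_subtractf right_diff_distrib)
      also have "\<dots> \<le> 2 * real N * (1 / real (Suc K)) / (1 - t) + 2 * real N"
      proof -
        have "(\<Sum>n=1..K. f n / real n) = Re (L_sum K)" by (simp add: L_sum_def f_def)
        also have "\<dots> \<le> 2 * real N * (1 / real (Suc K))"
          using norm_L_sum_diff[of K] L1 complex_Re_le_cmod[of "L_sum K"] by simp
        finally have 1: "(\<Sum>n=1..K. f n / real n) / (1 - t) \<le> 2 * real N * (1 / real (Suc K)) / (1 - t)"
          using t by (intro divide_right_mono) auto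
        have "norm (\<Sum>n=1..<Suc K. \<chi> n * of_real (lambert_weight t n)) \<le> 2 * real N * lambert_weight t 1"
          using lambert_weight_props[OF r] unfolding t_def
          by (intro abel_sum_bound norm_char_interval_sum_le) auto
        moreover have "lambert_weight t 1 = 1" using t by (simp add: lambert_weight_def field_simps)
        moreover have "(\<Sum>n=1..<Suc K. \<chi> n * of_real (lambert_weight t n)) =
            of_real (\<Sum>n=1..K. f n * lambert_weight t n)"
          unfolding \<chi>f by (simp add: atLeastLessThanSuc_atLeastAtMost)
        ultimately have "\<bar>\<Sum>n=1..K. f n * lambert_weight t n\<bar> \<le> 2 * real N"
          by (simp only: norm_of_real mult_1_right)
        then show ?thesis using 1 by linarith
      qed
      finally show ?thesis by (simp add: mult.commute)
    qed
    have "(\<lambda>K. 2 * real N + 2 * real N / (1 - t) * (1 / real (Suc K)) + real K * t ^ K / (1 - t)) \<longlonglongrightarrow>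
        2 * real N + 2 * real N / (1 - t) * 0 + 0 / (1 - t)"
      using t by (intro tendsto_intros LIMSEQ_Suc[OF lim_1_over_n] powser_times_n_limit_0) auto
    then show ?thesis
      unfolding t_def[symmetric] by (intro LIMSEQ_le_const[where X = "\<lambda>K. _ K"] exI[of _ "M ^ 2"]) (use main in auto)
  qed
  \<comment> \<open>The bound is uniform in \<open>r\<close> and \<open>M\<close>; letting
    \<open>r\<close> tend to 1 yields \<open>M \<le> 2 * N\<close>, which fails for this
    \<open>M\<close>.\<close>
  define M where "M = Suc (2 * N)"
  have "((\<lambda>r::real. \<Sum>j=1..M. (r ^ 2) ^ (j ^ 2)) \<longlongrightarrow> (\<Sum>j=1..M. (1 ^ 2) ^ (j ^ 2))) (at_left 1)"
    by (intro tendsto_intros)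
  moreover have "eventually (\<lambda>r::real. (\<Sum>j=1..M. (r ^ 2) ^ (j ^ 2)) \<le> 2 * real N) (at_left 1)"
    using eventually_at_left_real[of 0 "1 :: real"] by (rule eventually_mono) (use bound in auto)
  ultimately have "(\<Sum>j=1..M. (1 ^ 2) ^ (j ^ 2)) \<le> 2 * real N"
    by (rule tendsto_upperbound) simp
  then show False by (simp add: M_def)
qed

end

section \<open>Dirichlet's theorem\<close>

text \<open>Chebyshev's evaluation of \<open>ln (x!)\<close>: the factor \<open>x div d\<close>
  counts the multiples of \<open>d\<close> up to \<open>x\<close>.\<close>

lemma sum_ln_eq_sum_mangoldt:
  "(\<Sum>n=1..x. ln (real n)) = (\<Sum>d=1..x. mangoldt d * real (x div d))"
proof -
  have "(\<Sum>n=1..x. ln (real n)) = (\<Sum>n=1..x. \<Sum>d | d dvd n. mangoldt d)"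
    by (intro sum.cong refl) (simp add: mangoldt_sum[where ?'a = real, simplified])
  also have "\<dots> = (\<Sum>d=1..x. \<Sum>m=1..x div d. mangoldt d)" by (rule sum_divisors_swap)
  finally show ?thesis by (simp add: mult.commute)
qed

text \<open>One half of Mertens' estimate: in the formula for \<open>ln (x!)\<close> the factor
  \<open>x div d\<close> is at most \<open>x / d\<close>, and \<open>ln (x!)\<close> is at least
  \<open>x ln x - x\<close>.\<close>

lemma mangoldt_sum_ge:
  assumes "x \<ge> 1"
  shows "ln (real x) - 1 \<le> (\<Sum>d=1..x. mangoldt d / real d)"
proof -
  have "real x * ln (real x) - real x \<le> real x * ln (real x) - (\<Sum>d=1..x. ln (real x / real d))"
    using sum_ln_div_le[of x] by simp
  also have "\<dots> = (\<Sum>n=1..x. ln (real n))"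
  proof -
    have "(\<Sum>d=1..x. ln (real x / real d)) = (\<Sum>d=1..x. ln (real x) - ln (real d))"
      using assms by (intro sum.cong) (auto simp: ln_div)
    then show ?thesis by (simp add: sum_subtractf)
  qed
  also have "\<dots> \<le> (\<Sum>d=1..x. real x * (mangoldt d / real d))"
    unfolding sum_ln_eq_sum_mangoldt
  proof (rule sum_mono)
    fix d
    have "mangoldt d * real (x div d) \<le> mangoldt d * (real x / real d)"
      by (intro mult_left_mono mangoldt_nonneg) (simp add: of_nat_div_le_of_nat)
    then show "mangoldt d * real (x div d) \<le> real x * (mangoldt d / real d)" by (simp add: mult_ac)
  qed
  finally have "real x * (ln (real x) - 1) \<le> real x * (\<Sum>d=1..x. mangoldt d / real d)"
    by (simp add: sum_distrib_left algebra_simps)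
  then show ?thesis using assms by simp
qed

text \<open>
  The constant \<open>3/2\<close> is not optimal; that it is below 2 is what allows at most one \<open>L1 = 0\<close>.
\<close>
lemma mangoldt_sum_le:
  assumes "y \<ge> 1"
  shows "(\<Sum>d=1..y. mangoldt d / real d) \<le> 3 / 2 * ln (2 * real y)"
proof -
  \<comment> \<open>The comparison is with \<open>ln ((2 y)!)\<close>, but only for
    \<open>d \<le> y\<close>: there the floor \<open>q\<close> is at least 2, so that
    \<open>2 y / d < q + 1 \<le> 3/2 * q\<close>. Dividing \<open>2 y * ln (2 y)\<close> by
    \<open>4 y / 3\<close> then gives the constant.\<close>
  have "(\<Sum>d=1..y. 4 * real y / 3 * (mangoldt d / real d)) \<le> (\<Sum>d=1..y. mangoldt d * real (2 * y div d))"
  proof (rule sum_mono)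
    fix d assume d: "d \<in> {1..y}"
    define q where "q = 2 * y div d"
    have "2 \<le> q" using d unfolding q_def by (simp add: less_eq_div_iff_mult_less_eq)
    then have "2 * Suc q \<le> 3 * q" by simp
    then have "2 * (d * Suc q) \<le> 3 * (d * q)"
      using mult_le_mono2[of "2 * Suc q" "3 * q" d] by (simp only: mult.left_commute[of d])
    moreover have "2 * y < d * Suc q" using d dividend_less_times_div[of d "2 * y"] by (simp add: q_def)
    ultimately have "4 * y \<le> 3 * (d * q)" by linarith
    then have "real (4 * y) \<le> real (3 * (d * q))" by (simp only: of_nat_le_iff)
    then have "4 * real y / 3 / real d \<le> real q" using d by (simp add: divide_simps mult_ac)
    from mult_left_mono[OF this mangoldt_nonneg[of d]]
    show "4 * real y / 3 * (mangoldt d / real d) \<le> mangoldt d * real (2 * y div d)"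
      by (simp add: q_def mult_ac)
  qed
  also have "\<dots> \<le> (\<Sum>d=1..2*y. mangoldt d * real (2 * y div d))"
    by (intro sum_mono2) (auto simp: mangoldt_nonneg)
  also have "\<dots> = (\<Sum>n=1..2*y. ln (real n))" by (rule sum_ln_eq_sum_mangoldt[symmetric])
  also have "\<dots> \<le> (\<Sum>n=1..2*y. ln (2 * real y))"
    by (intro sum_mono) (use assms in auto)
  finally have "4 * real y / 3 * (\<Sum>d=1..y. mangoldt d / real d) \<le> 4 * real y / 3 * (3 / 2 * ln (2 * real y))"
    by (simp add: sum_distrib_left)
  then show ?thesis using assms by simp
qed

text \<open>Telescoping against \<open>2 / sqrt n\<close>, as in the comparison with an
  integral.\<close>

lemma sum_inverse_three_halves_le: "(\<Sum>q=2..x. 1 / (real q * sqrt (real q))) \<le> 2"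
proof -
  have "(\<Sum>q=2..Suc n. 1 / (real q * sqrt (real q))) \<le> 2 - 2 / sqrt (real (Suc n))" for n
  proof (induction n)
    case (Suc n)
    define a c where "a = sqrt (real (Suc n))" and "c = sqrt (real (Suc (Suc n)))"
    have ac: "0 < a" "a \<le> c" "c ^ 2 - a ^ 2 = 1" by (auto simp: a_def c_def)
    then have "c > 0" by simp
    have "a * (a + c) \<le> c * (c + c)" using ac by (intro mult_mono) auto
    then have "a * (a + c) * (c - a) \<le> 2 * c ^ 2 * (c - a)"
      using ac by (intro mult_right_mono) (auto simp: power2_eq_square)
    moreover have "(a + c) * (c - a) = 1" using ac(3) by (simp add: algebra_simps power2_eq_square)
    ultimately have "a \<le> 2 * c ^ 2 * (c - a)" by (metis mult.assoc mult.right_neutral)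
    then have "1 / (c ^ 2 * c) \<le> 2 / a - 2 / c"
    proof -
      assume "a \<le> 2 * c ^ 2 * (c - a)"
      then have "a / (a * (c ^ 2 * c)) \<le> 2 * c ^ 2 * (c - a) / (a * (c ^ 2 * c))"
        using ac by (intro divide_right_mono) auto
      also have "\<dots> = 2 / a - 2 / c" using ac(1) \<open>c > 0\<close> by (simp add: field_simps power2_eq_square)
      finally show ?thesis using ac by simp
    qed
    then have "1 / (real (Suc (Suc n)) * sqrt (real (Suc (Suc n)))) \<le>
        2 / sqrt (real (Suc n)) - 2 / sqrt (real (Suc (Suc n)))"
      by (simp add: a_def c_def del: of_nat_Suc)
    then show ?case using Suc by (simp del: of_nat_Suc)
  qed simp
  moreover have "2 - 2 / sqrt (real (Suc n)) \<le> 2" for n by simp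
  ultimately have "(\<Sum>q=2..Suc n. 1 / (real q * sqrt (real q))) \<le> 2" for n by (rule order_trans)
  then show ?thesis by (cases x) auto
qed

text \<open>Only prime powers \<open>q ^ k\<close> with \<open>k \<ge> 2\<close> contribute. For
  fixed \<open>q\<close> the geometric sum over \<open>k\<close> is at most
  \<open>2 / q ^ 2\<close>, and \<open>ln q \<le> 2 * sqrt q\<close> leaves a convergent
  series.\<close>

lemma mangoldt_sum_nonprime_bounded:
  obtains C where "\<And>x. (\<Sum>n | n \<in> {1..x} \<and> \<not> prime n. mangoldt n / real n) \<le> C"
proof -
  define h where "h q = 4 * (1 / (real q * sqrt (real q)))" for q :: nat
  have "(\<Sum>n | n \<in> {1..x} \<and> \<not> prime n. mangoldt n / real n) \<le> 8" for x
  proof -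
    \<comment> \<open>Base and exponent of a prime power \<open>q ^ k \<le> x\<close> are both at
      most \<open>x\<close>, so this finite box covers all the terms.\<close>
    define P where "P = {q\<in>{2..x}. prime q} \<times> {2..x}"
    define S where "S = (\<lambda>(q, k). q ^ k) ` P"
    have fin: "finite P" "finite S" by (auto simp: P_def S_def)
    have "(\<Sum>n | n \<in> {1..x} \<and> \<not> prime n. mangoldt n / real n) =
        (\<Sum>n | n \<in> {1..x} \<and> \<not> prime n \<and> primepow n. mangoldt n / real n)"
      by (rule sum.mono_neutral_right) (auto simp: mangoldt_def)
    also have "\<dots> \<le> (\<Sum>n\<in>S. mangoldt n / real n)"
    proof (rule sum_mono2[OF fin(2)])
      show "{n. n \<in> {1..x} \<and> \<not> prime n \<and> primepow n} \<subseteq> S"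
      proof clarify
        fix n assume n: "n \<in> {1..x}" "\<not> prime n" "primepow n"
        then obtain q k where qk: "prime q" "k > 0" "n = q ^ k" by (auto simp: primepow_def)
        have "k \<noteq> 1" using n(2) qk by auto
        then have "k \<ge> 2" using qk by simp
        moreover have "k \<le> x"
        proof -
          have "k < 2 ^ k" by (rule less_exp)
          also have "\<dots> \<le> q ^ k" using prime_ge_2_nat[OF qk(1)] by (intro power_mono) auto
          finally show ?thesis using qk n by simp
        qed
        moreover have "q \<le> q ^ k" using qk prime_gt_0_nat[OF qk(1)] by (intro self_le_power) auto
        then have "q \<in> {2..x}" using n qk prime_ge_2_nat[OF qk(1)] by auto
        ultimately show "n \<in> S" unfolding S_def P_def using qk by (intro image_eqI[of _ _ "(q, k)"]) auto
      qed
    qed (simp add: mangoldt_nonneg)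
    also have "\<dots> \<le> (\<Sum>z\<in>P. ((\<lambda>n. mangoldt n / real n) \<circ> (\<lambda>(q, k). q ^ k)) z)"
      unfolding S_def by (intro sum_image_le fin) (simp add: mangoldt_nonneg)
    also have "\<dots> = (\<Sum>q | q \<in> {2..x} \<and> prime q. \<Sum>k=2..x. ln (real q) * (1 / real q) ^ k)"
      unfolding P_def by (subst sum.cartesian_product)
        (auto intro!: sum.cong simp: mangoldt_primepow power_one_over field_simps)
    also have "\<dots> \<le> (\<Sum>q | q \<in> {2..x} \<and> prime q. h q)"
    proof (rule sum_mono)
      fix q assume "q \<in> {q. q \<in> {2..x} \<and> prime q}"
      then have q: "q \<ge> 2" "x \<ge> 2" by auto
      define u where "u = 1 / real q"
      have u: "0 < u" "u \<le> 1 / 2" using q by (auto simp: u_def divide_simps)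
      have "(\<Sum>k=2..x. u ^ k) = (u ^ 2 - u ^ Suc x) / (1 - u)" using u q by (subst sum_gp) auto
      also have "\<dots> \<le> u ^ 2 / (1 / 2)" using u by (intro frac_le) auto
      finally have "ln (real q) * (\<Sum>k=2..x. u ^ k) \<le> 2 * sqrt (real q) * (2 * u ^ 2)"
        using q ln_powr_bound[of "real q" "1 / 2"] u by (intro mult_mono) (auto intro: sum_nonneg simp: powr_half_sqrt)
      also have "\<dots> = h q"
        using q by (simp add: h_def u_def divide_simps power2_eq_square)
      finally show "(\<Sum>k=2..x. ln (real q) * (1 / real q) ^ k) \<le> h q"
        by (simp add: sum_distrib_left u_def)
    qed
    also have "\<dots> \<le> (\<Sum>q=2..x. h q)"
      by (intro sum_mono2) (auto simp: h_def)
    also have "\<dots> \<le> 8"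
      using sum_inverse_three_halves_le[of x] unfolding h_def sum_distrib_left[symmetric] by simp
    finally show ?thesis .
  qed
  then show ?thesis using that by blast
qed

lemma ln_of_nat_unbounded:
  assumes "\<And>x::nat. x \<ge> 1 \<Longrightarrow> ln (real x) \<le> C"
  shows False
proof -
  define x where "x = nat \<lceil>exp (C + 1)\<rceil>"
  have ex: "exp (C + 1) \<le> real x" unfolding x_def by linarith
  then have "real x > 0" using exp_gt_zero[of "C + 1"] by linarith
  then have "x \<ge> 1" by simp
  moreover have "C + 1 \<le> ln (real x)" using ex \<open>real x > 0\<close> by (simp add: ln_ge_iff)
  ultimately show False using assms[of x] by simp
qed

text \<open>By orthogonality, the weights \<open>\<chi> b\<close> select the \<open>n\<close> that
  are inverse to \<open>b\<close> modulo \<open>N\<close>.\<close>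

lemma sum_chars_mangoldt:
  assumes "N > 0"
  shows "(\<Sum>\<chi>\<in>dirichlet_chars N. \<chi> b * dirichlet_char.mangoldt_sum_char \<chi> x) =
    of_real (real (card (dirichlet_chars N)) * (\<Sum>n | n \<in> {1..x} \<and> [b * n = 1] (mod N). mangoldt n / real n))"
proof -
  have "(\<Sum>\<chi>\<in>dirichlet_chars N. \<chi> b * dirichlet_char.mangoldt_sum_char \<chi> x) =
      (\<Sum>\<chi>\<in>dirichlet_chars N. \<Sum>n=1..x. \<chi> (b * n) * (mangoldt n / of_nat n))"
  proof (intro sum.cong refl)
    fix \<chi> assume \<chi>: "\<chi> \<in> dirichlet_chars N"
    then interpret dirichlet_char N \<chi> using assms by unfold_locales
    show "\<chi> b * mangoldt_sum_char x = (\<Sum>n=1..x. \<chi> (b * n) * (mangoldt n / of_nat n))"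
      by (simp add: mangoldt_sum_char_def sum_distrib_left dirichlet_charsD(2)[OF \<chi>] mult_ac)
  qed
  also have "\<dots> = (\<Sum>n=1..x. (\<Sum>\<chi>\<in>dirichlet_chars N. \<chi> (b * n)) * (mangoldt n / of_nat n))"
    by (subst sum.swap) (simp only: sum_distrib_right)
  also have "\<dots> = (\<Sum>n=1..x. if [b * n = 1] (mod N)
      then of_nat (card (dirichlet_chars N)) * (mangoldt n / of_nat n) else 0)"
    unfolding sum_dirichlet_chars[OF assms] by (intro sum.cong) auto
  also have "\<dots> = of_nat (card (dirichlet_chars N)) *
      (\<Sum>n | n \<in> {1..x} \<and> [b * n = 1] (mod N). mangoldt n / of_nat n)"
    unfolding sum_distrib_left by (simp add: sum.inter_filter flip: sum.inter_filter)
  finally show ?thesis by simp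
qed

context nonprincipal_dirichlet_char
begin

text \<open>For real \<open>\<chi>\<close> this is \<open>L1_nonzero_if_real\<close>. Otherwise
  \<open>L1\<close> would vanish also for the conjugate, a different character. Up to constants the
  two contribute \<open>- 2 * ln x\<close>, the principal character at most
  \<open>3/2 * ln x\<close>, and the others are bounded above, so the nonnegative sum over all
  characters would become negative.\<close>

lemma L1_nonzero: "L1 \<noteq> 0"
proof
  assume L1: "L1 = 0"
  define \<psi> where "\<psi> n = cnj (\<chi> n)" for n
  have "\<exists>n. \<psi> n \<noteq> \<chi> n" using L1 L1_nonzero_if_real unfolding \<psi>_def by blast
  then have ne: "\<psi> \<noteq> \<chi>" by auto
  have \<psi>: "\<psi> \<in> dirichlet_chars N"
    using cnj_dirichlet_char[OF char] by (simp add: \<psi>_def[abs_def])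
  have "\<exists>a. coprime a N \<and> \<psi> a \<noteq> 1" using nonprincipal by (simp add: \<psi>_def)
  then interpret psi: nonprincipal_dirichlet_char N \<psi> using \<psi> N_pos by unfold_locales
  have "psi.L_sum = (\<lambda>x. cnj (L_sum x))"
    by (auto simp: psi.L_sum_def L_sum_def \<psi>_def)
  moreover have "(\<lambda>x. cnj (L_sum x)) \<longlonglongrightarrow> cnj L1" by (intro tendsto_intros L_sum_tendsto)
  ultimately have \<psi>L1: "psi.L1 = 0" using psi.L_sum_tendsto L1 LIMSEQ_unique by fastforce

  define \<chi>\<^sub>0 :: "nat \<Rightarrow> complex" where "\<chi>\<^sub>0 n = (if coprime n N then 1 else 0)" for n
  have \<chi>\<^sub>0: "\<chi>\<^sub>0 \<in> dirichlet_chars N"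
    using principal_dirichlet_char[OF N_pos] by (simp add: \<chi>\<^sub>0_def[abs_def])
  have ne0: "\<chi> \<noteq> \<chi>\<^sub>0" "\<psi> \<noteq> \<chi>\<^sub>0"
    using nonprincipal psi.nonprincipal by (auto simp: \<chi>\<^sub>0_def)
  define B where "B \<xi> x = Re (dirichlet_char.mangoldt_sum_char \<xi> x)" for \<xi> x
  define Y where "Y = dirichlet_chars N - {\<chi>\<^sub>0, \<chi>, \<psi>}"
  have zero: "B \<chi> x \<le> 2 * real N - ln (real x)" "B \<psi> x \<le> 2 * real N - ln (real x)" if "x \<ge> 1" for x
    using order_trans[OF complex_Re_le_cmod mangoldt_sum_char_plus_ln_bounded[OF L1 that]]
      order_trans[OF complex_Re_le_cmod psi.mangoldt_sum_char_plus_ln_bounded[OF \<psi>L1 that]]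
    by (simp_all add: B_def)
  have "\<exists>K. \<forall>x\<ge>1. B \<xi> x \<le> K" if "\<xi> \<in> Y" for \<xi>
  proof -
    have \<xi>: "\<xi> \<in> dirichlet_chars N" "\<xi> \<noteq> \<chi>\<^sub>0" using that by (auto simp: Y_def)
    then have "\<exists>a. coprime a N \<and> \<xi> a \<noteq> 1"
      using dirichlet_charsD(4)[OF \<xi>(1)] by (metis \<chi>\<^sub>0_def ext)
    then interpret xi: nonprincipal_dirichlet_char N \<xi> using \<xi> N_pos by unfold_locales
    show ?thesis
    proof (cases "xi.L1 = 0")
      case True
      \<comment> \<open>Only upper bounds matter here: a further vanishing \<open>L1\<close> would
        make the sum tend to minus infinity, which is harmless.\<close>
      have ln0: "ln (real x) \<ge> 0" if "x \<ge> 1" for x :: nat using that by simp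
      have "B \<xi> x \<le> 2 * real N" if "x \<ge> 1" for x
        using order_trans[OF complex_Re_le_cmod xi.mangoldt_sum_char_plus_ln_bounded[OF True that]]
          ln0[OF that] by (simp add: B_def)
      then show ?thesis by blast
    next
      case False
      then show ?thesis using xi.mangoldt_sum_char_bounded unfolding B_def
        by (meson complex_Re_le_cmod order_trans)
    qed
  qed
  then obtain K where K: "\<And>\<xi> x. \<xi> \<in> Y \<Longrightarrow> x \<ge> 1 \<Longrightarrow> B \<xi> x \<le> K \<xi>" by metis
  have "ln (real x) \<le> 2 * (3 / 2 * ln 2 + 4 * real N + (\<Sum>\<xi>\<in>Y. K \<xi>))" if x: "x \<ge> 1" for x
  proof -
    have fin: "finite (dirichlet_chars N)" by (rule finite_dirichlet_chars[OF N_pos])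
    have "dirichlet_chars N = insert \<chi>\<^sub>0 (insert \<chi> (insert \<psi> Y))"
      using \<chi>\<^sub>0 char \<psi> by (auto simp: Y_def)
    moreover have "\<chi>\<^sub>0 \<notin> insert \<chi> (insert \<psi> Y)" "\<chi> \<notin> insert \<psi> Y" "\<psi> \<notin> Y" "finite Y"
      using ne ne0 fin by (auto simp: Y_def)
    ultimately have "(\<Sum>\<xi>\<in>dirichlet_chars N. B \<xi> x) = B \<chi>\<^sub>0 x + (B \<chi> x + (B \<psi> x + (\<Sum>\<xi>\<in>Y. B \<xi> x)))"
      by simp
    \<comment> \<open>For \<open>b = 1\<close>, orthogonality turns the sum into a nonnegative
      multiple of a sum of nonnegative terms.\<close>
    moreover have "(\<Sum>\<xi>\<in>dirichlet_chars N. B \<xi> x) \<ge> 0"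
    proof -
      have "(\<Sum>\<xi>\<in>dirichlet_chars N. \<xi> 1 * dirichlet_char.mangoldt_sum_char \<xi> x) =
          (\<Sum>\<xi>\<in>dirichlet_chars N. dirichlet_char.mangoldt_sum_char \<xi> x)"
        by (intro sum.cong) (auto simp: dirichlet_charsD(1)[simplified])
      then have "(\<Sum>\<xi>\<in>dirichlet_chars N. B \<xi> x) =
          Re (\<Sum>\<xi>\<in>dirichlet_chars N. \<xi> 1 * dirichlet_char.mangoldt_sum_char \<xi> x)"
        by (simp add: B_def)
      also have "\<dots> \<ge> 0"
        unfolding sum_chars_mangoldt[OF N_pos] Re_complex_of_real
        by (intro mult_nonneg_nonneg sum_nonneg) (auto simp: mangoldt_nonneg)
      finally show ?thesis .
    qed
    moreover have "(\<Sum>\<xi>\<in>Y. B \<xi> x) \<le> (\<Sum>\<xi>\<in>Y. K \<xi>)" by (intro sum_mono K x)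
    moreover have "B \<chi>\<^sub>0 x \<le> 3 / 2 * ln (2 * real x)"
    proof -
      interpret zero: dirichlet_char N \<chi>\<^sub>0 using \<chi>\<^sub>0 N_pos by unfold_locales
      have "B \<chi>\<^sub>0 x = (\<Sum>n=1..x. Re (\<chi>\<^sub>0 n) * (mangoldt n / real n))"
        unfolding B_def zero.mangoldt_sum_char_def Re_sum by (intro sum.cong) (auto simp: \<chi>\<^sub>0_def)
      also have "\<dots> \<le> (\<Sum>n=1..x. mangoldt n / real n)"
        by (intro sum_mono) (auto simp: \<chi>\<^sub>0_def mangoldt_nonneg)
      also have "\<dots> \<le> 3 / 2 * ln (2 * real x)" by (rule mangoldt_sum_le[OF x])
      finally show ?thesis .
    qed
    moreover have "ln (2 * real x) = ln 2 + ln (real x)" using x by (simp add: ln_mult)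
    ultimately show ?thesis using zero[OF x] by simp
  qed
  then show False by (rule ln_of_nat_unbounded)
qed

end

text \<open>Without such a prime, the von Mangoldt sum over the class of \<open>c\<close> consists
  of nonprime terms and is bounded. As the nonprincipal characters have bounded sums, so has the
  principal one, whereas the full sum is at least \<open>ln x - 1\<close>.\<close>

theorem dirichlet_prime_in_residue_class:
  fixes c N :: nat
  assumes N: "N > 0" and c: "coprime c N"
  shows "\<exists>q. prime q \<and> [q = c] (mod N)"
proof (rule ccontr)
  assume no: "\<not> ?thesis"
  obtain b where b: "[c * b = 1] (mod N)" using cong_solve_coprime_nat[OF c] by auto
  obtain C where C: "\<And>x. (\<Sum>n | n \<in> {1..x} \<and> \<not> prime n. mangoldt n / real n) \<le> C"
    by (rule mangoldt_sum_nonprime_bounded) blast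
  define \<chi>\<^sub>0 :: "nat \<Rightarrow> complex" where "\<chi>\<^sub>0 n = (if coprime n N then 1 else 0)" for n
  have \<chi>\<^sub>0: "\<chi>\<^sub>0 \<in> dirichlet_chars N"
    using principal_dirichlet_char[OF N] by (simp add: \<chi>\<^sub>0_def[abs_def])
  define X where "X = dirichlet_chars N"
  define B where "B \<xi> x = dirichlet_char.mangoldt_sum_char \<xi> x" for \<xi> x
  have "\<exists>K. \<forall>x\<ge>1. norm (\<xi> b * B \<xi> x) \<le> K" if \<xi>: "\<xi> \<in> X - {\<chi>\<^sub>0}" for \<xi>
  proof -
    have \<xi>: "\<xi> \<in> dirichlet_chars N" "\<xi> \<noteq> \<chi>\<^sub>0" using that by (auto simp: X_def)
    then have "\<exists>a. coprime a N \<and> \<xi> a \<noteq> 1"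
      using dirichlet_charsD(4)[OF \<xi>(1)] by (metis \<chi>\<^sub>0_def ext)
    then interpret xi: nonprincipal_dirichlet_char N \<xi> using \<xi> N by unfold_locales
    obtain K where K: "\<forall>x\<ge>1. norm (xi.mangoldt_sum_char x) \<le> K"
      using xi.mangoldt_sum_char_bounded[OF xi.L1_nonzero] by blast
    have "norm (\<xi> b * B \<xi> x) \<le> 1 * K" if "x \<ge> 1" for x
      unfolding norm_mult B_def using K that norm_dirichlet_char_le[OF \<xi>(1) N]
      by (intro mult_mono) auto
    then show ?thesis by blast
  qed
  then obtain K where K: "\<And>\<xi> x. \<xi> \<in> X - {\<chi>\<^sub>0} \<Longrightarrow> x \<ge> 1 \<Longrightarrow> norm (\<xi> b * B \<xi> x) \<le> K \<xi>" by metis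
  have bN: "coprime b N"
    using b cong_imp_coprime cong_sym coprime_1_left coprime_mult_left_iff by blast
  define D where "D = real (card X) * C + (\<Sum>\<xi>\<in>X - {\<chi>\<^sub>0}. K \<xi>) + C + (\<Sum>n=1..N. mangoldt n / real n) + 1"
  have "ln (real x) \<le> D" if x: "x \<ge> 1" for x
  proof -
    define w where "w n = (mangoldt n / real n :: real)" for n
    have w0: "w n \<ge> 0" for n by (simp add: w_def mangoldt_nonneg)
    have fin: "finite X" unfolding X_def by (rule finite_dirichlet_chars[OF N])
    have "\<chi>\<^sub>0 b * B \<chi>\<^sub>0 x = (\<Sum>\<xi>\<in>X. \<xi> b * B \<xi> x) - (\<Sum>\<xi>\<in>X - {\<chi>\<^sub>0}. \<xi> b * B \<xi> x)"
      using fin \<chi>\<^sub>0 by (simp add: X_def sum.remove[of "dirichlet_chars N" \<chi>\<^sub>0])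
    also have "norm \<dots> \<le> real (card X) * C + (\<Sum>\<xi>\<in>X - {\<chi>\<^sub>0}. K \<xi>)"
    proof (intro norm_triangle_le_diff add_mono)
      \<comment> \<open>The \<open>n\<close> inverse to \<open>b\<close> form the class of
        \<open>c\<close>, which by assumption contains no prime.\<close>
      have "(\<Sum>n | n \<in> {1..x} \<and> [b * n = 1] (mod N). w n) \<le> (\<Sum>n | n \<in> {1..x} \<and> \<not> prime n. w n)"
      proof (rule sum_mono2)
        have "[n = c] (mod N)" if "[b * n = 1] (mod N)" for n
        proof -
          have "[b * n = b * c] (mod N)" using that b by (metis cong_sym cong_trans mult.commute)
          then show ?thesis using bN by (simp add: cong_mult_lcancel_nat)
        qed
        then show "{n. n \<in> {1..x} \<and> [b * n = 1] (mod N)} \<subseteq> {n. n \<in> {1..x} \<and> \<not> prime n}"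
          using no by blast
      qed (use w0 in auto)
      also have "\<dots> \<le> C" unfolding w_def by (rule C)
      finally show "norm (\<Sum>\<xi>\<in>X. \<xi> b * B \<xi> x) \<le> real (card X) * C"
        unfolding X_def B_def sum_chars_mangoldt[OF N] norm_of_real
        using w0 by (simp add: abs_mult sum_nonneg mult_left_mono flip: w_def)
      show "norm (\<Sum>\<xi>\<in>X - {\<chi>\<^sub>0}. \<xi> b * B \<xi> x) \<le> (\<Sum>\<xi>\<in>X - {\<chi>\<^sub>0}. K \<xi>)"
        by (intro sum_norm_le K x)
    qed
    also have "\<chi>\<^sub>0 b = 1" using bN by (simp add: \<chi>\<^sub>0_def)
    finally have 1: "norm (B \<chi>\<^sub>0 x) \<le> real (card X) * C + (\<Sum>\<xi>\<in>X - {\<chi>\<^sub>0}. K \<xi>)" by simp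
    have split: "(\<Sum>n=1..x. w n) = (\<Sum>n | n \<in> {1..x} \<and> coprime n N. w n) + (\<Sum>n | n \<in> {1..x} \<and> \<not> coprime n N. w n)"
      by (subst sum.union_disjoint[symmetric]) (auto intro!: sum.cong)
    interpret zero: dirichlet_char N \<chi>\<^sub>0 using \<chi>\<^sub>0 N by unfold_locales
    have "B \<chi>\<^sub>0 x = (\<Sum>n=1..x. if coprime n N then of_real (w n) else 0)"
      unfolding B_def zero.mangoldt_sum_char_def \<chi>\<^sub>0_def by (intro sum.cong) (auto simp: w_def)
    also have "\<dots> = of_real (\<Sum>n | n \<in> {1..x} \<and> coprime n N. w n)"
      by (simp add: sum.inter_filter flip: sum.inter_filter)
    finally have 2: "(\<Sum>n | n \<in> {1..x} \<and> coprime n N. w n) \<le> norm (B \<chi>\<^sub>0 x)"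
      by (simp only: norm_of_real abs_ge_self)
    \<comment> \<open>An \<open>n\<close> not coprime to \<open>N\<close> is either not prime or a
      prime divisor of \<open>N\<close>, hence at most \<open>N\<close>.\<close>
    have "(\<Sum>n | n \<in> {1..x} \<and> \<not> coprime n N. w n) \<le>
        (\<Sum>n \<in> {n. n \<in> {1..x} \<and> \<not> prime n} \<union> {1..N}. w n)"
    proof (rule sum_mono2)
      have "n \<le> N" if "prime n" "\<not> coprime n N" for n
        using that N prime_imp_coprime dvd_imp_le by blast
      then show "{n. n \<in> {1..x} \<and> \<not> coprime n N} \<subseteq> {n. n \<in> {1..x} \<and> \<not> prime n} \<union> {1..N}" by auto
    qed (use w0 in auto)
    also have "\<dots> \<le> (\<Sum>n | n \<in> {1..x} \<and> \<not> prime n. w n) + (\<Sum>n=1..N. w n)"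
      using w0 by (subst sum_Un) (auto intro: sum_nonneg)
    also have "\<dots> \<le> C + (\<Sum>n=1..N. w n)" unfolding w_def by (intro add_right_mono C)
    finally have 3: "(\<Sum>n | n \<in> {1..x} \<and> \<not> coprime n N. w n) \<le> C + (\<Sum>n=1..N. w n)" .
    have "ln (real x) - 1 \<le> (\<Sum>n=1..x. w n)" unfolding w_def by (rule mangoldt_sum_ge[OF x])
    then show ?thesis using split 1 2 3 unfolding D_def w_def[symmetric] by linarith
  qed
  then show False by (rule ln_of_nat_unbounded)
qed

section \<open>Local singular arithmetical congruence monoids\<close>

text \<open>This expresses that consecutive elements differ by at most \<open>d\<close>, without
  enumerating the set in order.\<close>

definition gaps_at_most :: "nat \<Rightarrow> nat set \<Rightarrow> bool" where
  "gaps_at_most d S \<longleftrightarrow> (\<forall>l\<in>S. \<forall>l'\<in>S. l < l' \<longrightarrow> (\<exists>m\<in>S. l < m \<and> m \<le> l + d))"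

text \<open>If neither \<open>l'\<close> nor a nearby \<open>t\<close> settles the matter, the
  largest element \<open>t0\<close> of \<open>T\<close> up to \<open>l\<close> is followed in
  \<open>T\<close> by an element within \<open>d\<close>; it exceeds \<open>l\<close> by maximality
  and is at most \<open>l + d\<close>.\<close>

lemma gaps_at_most_extend:
  assumes T: "gaps_at_most d T" "T \<subseteq> S" and near: "\<And>l. l \<in> S \<Longrightarrow> \<exists>t\<in>T. t \<le> l + d \<and> l \<le> t + d"
  shows "gaps_at_most d S"
  unfolding gaps_at_most_def
proof (intro ballI impI)
  fix l l' assume l: "l \<in> S" "l' \<in> S" "l < l'"
  obtain t where t: "t \<in> T" "t \<le> l + d" using near[OF l(1)] by blast
  obtain t' where t': "t' \<in> T" "l' \<le> t' + d" using near[OF l(2)] by blast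
  show "\<exists>m\<in>S. l < m \<and> m \<le> l + d"
  proof (cases "l' \<le> l + d \<or> t > l")
    case True
    then show ?thesis using l t T(2) by blast
  next
    case False
    define t0 where "t0 = Max {s\<in>T. s \<le> l}"
    have fin: "finite {s\<in>T. s \<le> l}" "{s\<in>T. s \<le> l} \<noteq> {}" using t False by auto
    have t0: "t0 \<in> T" "t0 \<le> l" using Max_in[OF fin] by (auto simp: t0_def)
    have "t0 < t'" using t0 t' False by linarith
    then obtain m where m: "m \<in> T" "t0 < m" "m \<le> t0 + d"
      using T(1) t0(1) t'(1) unfolding gaps_at_most_def by blast
    have "l < m"
    proof (rule ccontr)
      assume "\<not> l < m"
      then have "m \<le> t0" unfolding t0_def using m fin by (intro Max_ge) auto
      then show False using m by simp
    qed
    then show ?thesis using m t0 T(2) by (intro bexI[of _ m]) auto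
  qed
qed

text \<open>The number of elements below \<open>l\<close> counts the gaps between the minimum and
  \<open>l\<close>. Applied to length sets, this is the lower bound \<open>1 / d\<close> for the
  length density.\<close>

lemma gaps_at_most_Max_le:
  assumes gaps: "gaps_at_most d S" and S: "finite S" "S \<noteq> {}"
  shows "Max S \<le> Min S + d * (card S - 1)"
proof -
  have "l \<in> S \<Longrightarrow> l \<le> Min S + d * card {m\<in>S. m < l}" for l
  proof (induction l rule: less_induct)
    case (less l)
    show ?case
    proof (cases "{m\<in>S. m < l} = {}")
      case True
      then have "l \<le> Min S" using S by (auto simp: not_less)
      then show ?thesis by simp
    next
      case False
      define l0 where "l0 = Max {m\<in>S. m < l}"
      have fin: "finite {m\<in>S. m < l}" using S by simp
      have l0: "l0 \<in> S" "l0 < l" using Max_in[OF fin False] by (auto simp: l0_def)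
      have le_l0: "m \<le> l0" if "m \<in> S" "m < l" for m
        unfolding l0_def using that fin by (intro Max_ge) auto
      obtain m where "m \<in> S" "l0 < m" "m \<le> l0 + d"
        using gaps l0 less.prems unfolding gaps_at_most_def by blast
      then have "l \<le> l0 + d" using le_l0[of m] by linarith
      moreover have "{m\<in>S. m < l} = insert l0 {m\<in>S. m < l0}"
        using l0 le_l0 by (auto simp: le_less)
      then have "card {m\<in>S. m < l} = Suc (card {m\<in>S. m < l0})" using S by simp
      ultimately show ?thesis using less.IH[OF l0(2,1)] by simp
    qed
  qed
  from this[of "Max S"] have "Max S \<le> Min S + d * card {m\<in>S. m < Max S}" using S by simp
  also have "{m\<in>S. m < Max S} = S - {Max S}" using S by (auto simp: less_le)
  finally show ?thesis using S by simp
qed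

text \<open>The element \<open>c\<close> carries the weight of \<open>S\<close> over the threshold;
  it is found by discarding elements as long as the weight of the rest stays at least
  \<open>k\<close>.\<close>

lemma exists_submultiset_crossing:
  fixes w :: "'a \<Rightarrow> nat"
  assumes "\<Sum>\<^sub># (image_mset w A) \<ge> k" "k > 0"
  obtains S c where "add_mset c S \<subseteq># A" "\<Sum>\<^sub># (image_mset w S) < k" "k \<le> \<Sum>\<^sub># (image_mset w S) + w c"
proof -
  have "\<exists>S c. add_mset c S \<subseteq># A \<and> \<Sum>\<^sub># (image_mset w S) < k \<and> k \<le> \<Sum>\<^sub># (image_mset w S) + w c"
    using assms(1)
  proof (induction A)
    case (add a A)
    show ?case
    proof (cases "\<Sum>\<^sub># (image_mset w A) \<ge> k")
      case True
      then obtain S c where "add_mset c S \<subseteq># A" "\<Sum>\<^sub># (image_mset w S) < k" "k \<le> \<Sum>\<^sub># (image_mset w S) + w c"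
        using add.IH by blast
      moreover have "A \<subseteq># add_mset a A" by simp
      ultimately show ?thesis using subset_mset.order_trans by blast
    next
      case False
      then show ?thesis using add.prems by (intro exI[of _ A] exI[of _ a]) (auto simp: add.commute)
    qed
  qed (use assms(2) in simp)
  then show ?thesis using that by blast
qed

section \<open>Atoms and lengths in the monoid\<close>

text \<open>The parameters \<open>a\<close> and \<open>b\<close> enter only through divisibility and
  residue conditions, see \<open>acm_iff\<close>. For positive \<open>\<beta>\<close>,
  \<open>p ^ \<beta> \<in> M\<close> forces \<open>\<alpha> \<le> \<beta>\<close>, so
  \<open>\<alpha> < \<beta>\<close> says that the two differ.\<close>

locale local_singular_acm =
  fixes p \<alpha> \<beta> f :: nat and M :: "nat set"
  assumes p: "prime p" and \<alpha>: "0 < \<alpha>" and f: "0 < f" "coprime p f"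
    and M_iff: "\<And>x. x \<in> M \<longleftrightarrow> x = 1 \<or> (0 < x \<and> p ^ \<alpha> dvd x \<and> [x = 1] (mod f))"
    and \<beta>: "p ^ \<beta> \<in> M" "\<alpha> < \<beta>" "\<And>n. 0 < n \<Longrightarrow> p ^ n \<in> M \<Longrightarrow> \<beta> \<le> n"
begin

abbreviation v :: "nat \<Rightarrow> nat" where "v \<equiv> multiplicity p"

text \<open>The predecessor makes the inequality strict: this is the largest \<open>k\<close> with
  \<open>k * \<alpha> < \<beta>\<close>, also when \<open>\<alpha>\<close> divides
  \<open>\<beta>\<close>.\<close>

definition \<delta> :: nat where "\<delta> = (\<beta> - 1) div \<alpha>"

lemma \<delta>_pos: "1 \<le> \<delta>"
  unfolding \<delta>_def using \<alpha> \<beta>(2) by (simp add: less_eq_div_iff_mult_less_eq)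

lemma le_\<delta>I: "k * \<alpha> < \<beta> \<Longrightarrow> k \<le> \<delta>"
  unfolding \<delta>_def using \<alpha> by (simp add: less_eq_div_iff_mult_less_eq)

lemma \<delta>_bounds: "\<delta> * \<alpha> < \<beta>" "\<beta> \<le> \<delta> * \<alpha> + \<alpha>"
  using \<alpha> \<beta>(2) div_times_less_eq_dividend[of "\<beta> - 1" \<alpha>] dividend_less_div_times[of \<alpha> "\<beta> - 1"]
  unfolding \<delta>_def by linarith+

lemma one_in_M [simp]: "1 \<in> M" and one_in_M' [simp]: "Suc 0 \<in> M" by (simp_all add: M_iff)

lemma M_pos: "x \<in> M \<Longrightarrow> 0 < x"
  by (auto simp: M_iff)

lemma M_cong: "x \<in> M \<Longrightarrow> [x = 1] (mod f)"
  by (auto simp: M_iff)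

lemma M_mult:
  assumes "x \<in> M" "y \<in> M"
  shows "x * y \<in> M"
proof (cases "x = 1")
  case False
  then have "p ^ \<alpha> dvd x * y" "0 < x * y" using assms M_pos by (auto simp: M_iff)
  moreover have "[x * y = 1] (mod f)" using cong_mult[OF assms[THEN M_cong]] by simp
  ultimately show ?thesis by (simp add: M_iff)
qed (use assms in simp)

lemma M_prod_mset: "set_mset A \<subseteq> M \<Longrightarrow> prod_mset A \<in> M"
  by (induction A) (auto intro: M_mult)

lemma M_iff_v: "0 < x \<Longrightarrow> x \<in> M \<longleftrightarrow> x = 1 \<or> (\<alpha> \<le> v x \<and> [x = 1] (mod f))"
  using power_dvd_iff_le_multiplicity[of x p \<alpha>] prime_gt_1_nat[OF p] by (auto simp: M_iff)

lemma v_ge: "x \<in> M \<Longrightarrow> x \<noteq> 1 \<Longrightarrow> \<alpha> \<le> v x"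
  using M_iff_v M_pos by blast

lemma v_mult: "0 < x \<Longrightarrow> 0 < y \<Longrightarrow> v (x * y) = v x + v y"
  using p by (simp add: prime_elem_multiplicity_mult_distrib prime_imp_prime_elem)

lemma v_prod_mset: "set_mset A \<subseteq> M \<Longrightarrow> v (prod_mset A) = \<Sum>\<^sub># (image_mset v A)"
  by (induction A) (auto simp: v_mult M_pos M_prod_mset)

lemma \<beta>_cong: "[p ^ \<beta> = 1] (mod f)"
  using \<beta>(1) by (rule M_cong)

lemma cong_cancel:
  assumes "[x * y = 1] (mod f)" "[x = 1] (mod f)"
  shows "[y = 1] (mod f)"
  using cong_trans[OF cong_sym[OF cong_scalar_right[OF assms(2), of y]] assms(1)] by simp

text \<open>Division by \<open>p ^ \<beta>\<close> leaves valuation at least \<open>\<alpha>\<close>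
  and keeps the residue 1, as \<open>p ^ \<beta>\<close> is itself 1 modulo
  \<open>f\<close>.\<close>

lemma split_off_p_power:
  assumes x: "x \<in> M" and "\<alpha> + \<beta> \<le> v x"
  obtains y where "y \<in> M" "y \<noteq> 1" "x = p ^ \<beta> * y" "v x = \<beta> + v y"
proof -
  have "p ^ \<beta> dvd x" using assms(2) by (intro multiplicity_dvd') simp
  then obtain y where y: "x = p ^ \<beta> * y" by blast
  then have "0 < y" using M_pos[OF x] by (intro Nat.gr0I) simp
  then have v: "v x = \<beta> + v y" using p y by (simp add: v_mult prime_gt_0_nat)
  then have "\<alpha> \<le> v y" using assms(2) by simp
  moreover have "[y = 1] (mod f)" using M_cong[OF x] \<beta>_cong unfolding y by (rule cong_cancel)
  ultimately have "y \<in> M" using M_iff_v[OF \<open>0 < y\<close>] by blast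
  moreover have "y \<noteq> 1" using \<open>\<alpha> \<le> v y\<close> \<alpha> by auto
  ultimately show ?thesis using that y v by blast
qed

lemma atomD:
  assumes "x \<in> atoms M"
  shows "x \<in> M" "x \<noteq> 1" "\<alpha> \<le> v x" "v x < \<alpha> + \<beta>"
proof -
  show x: "x \<in> M" "x \<noteq> 1" using assms by (auto simp: atoms_def)
  then show "\<alpha> \<le> v x" by (rule v_ge)
  show "v x < \<alpha> + \<beta>"
  proof (rule ccontr)
    assume "\<not> ?thesis"
    then obtain y where "y \<in> M" "y \<noteq> 1" "x = p ^ \<beta> * y" using split_off_p_power[OF x(1)] by (metis not_less)
    moreover have "p ^ \<beta> \<noteq> 1" using p \<beta>(2) by (simp add: prime_nat_iff)
    ultimately show False using assms \<beta>(1) by (auto simp: atoms_def)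
  qed
qed

lemma atoms_subset: "atoms M \<subseteq> M"
  using atomD(1) by blast

text \<open>A product of two nonunits has valuation at least \<open>2 * \<alpha>\<close>.\<close>

lemma atomI:
  assumes "x \<in> M" "x \<noteq> 1" "v x < 2 * \<alpha>"
  shows "x \<in> atoms M"
proof -
  have "x \<noteq> y * z" if "y \<in> M - {1}" "z \<in> M - {1}" for y z
    using assms(3) v_mult[of y z] v_ge[of y] v_ge[of z] M_pos[of y] M_pos[of z] that by auto
  then show ?thesis using assms by (auto simp: atoms_def)
qed

text \<open>Nontrivial factors in \<open>M\<close> would again be powers of \<open>p\<close>, so by
  minimality of \<open>\<beta>\<close> both would have exponent at least
  \<open>\<beta>\<close>.\<close>

lemma p_power_atom: "p ^ \<beta> \<in> atoms M"
proof -
  have "p ^ \<beta> \<noteq> y * z" if yz: "y \<in> M - {1}" "z \<in> M - {1}" for y z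
  proof
    assume eq: "p ^ \<beta> = y * z"
    have vp: "v (p ^ i) = i" for i using p by simp
    have ge: "\<beta> \<le> v u" if u: "u dvd p ^ \<beta>" "u \<in> M" "u \<noteq> 1" for u
    proof -
      obtain i where i: "u = p ^ i" using u(1) unfolding divides_primepow_nat[OF p] by auto
      then have "i \<noteq> 0" using that(3) by (metis power_0)
      then show ?thesis using \<beta>(3)[of i] that(2) unfolding i vp by blast
    qed
    have "\<beta> \<le> v y" "\<beta> \<le> v z" using yz by (intro ge; simp add: eq)+
    moreover have "\<beta> = v y + v z" using yz vp[of \<beta>] unfolding eq by (simp add: v_mult M_pos)
    ultimately show False using \<beta>(2) by linarith
  qed
  then show ?thesis using \<beta> p by (auto simp: atoms_def prime_nat_iff)
qed

lemma length_set_nonempty: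
  assumes "x \<in> M"
  shows "length_set M x \<noteq> {}"
  using assms
proof (induction x rule: less_induct)
  case (less x)
  consider "x = 1" | "x \<in> atoms M" | "x \<noteq> 1" "x \<notin> atoms M" by blast
  then show ?case
  proof cases
    case 1
    then have "0 \<in> length_set M x" by (simp add: length_set_def)
    then show ?thesis by blast
  next
    case 2
    then have "set_mset {#x#} \<subseteq> atoms M \<and> prod_mset {#x#} = x" by simp
    then show ?thesis unfolding length_set_def by blast
  next
    case 3
    then obtain y z where yz: "y \<in> M" "y \<noteq> 1" "z \<in> M" "z \<noteq> 1" "x = y * z"
      using less.prems by (auto simp: atoms_def)
    then have "1 < y" "1 < z" using M_pos[of y] M_pos[of z] by auto
    then have "y < x" "z < x" using yz(5) by auto
    then obtain A B where "set_mset A \<subseteq> atoms M" "prod_mset A = y" "set_mset B \<subseteq> atoms M" "prod_mset B = z"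
      using less.IH[of y] less.IH[of z] yz by (auto simp: length_set_def)
    then have "set_mset (A + B) \<subseteq> atoms M \<and> prod_mset (A + B) = x" using yz(5) by auto
    then show ?thesis unfolding length_set_def by blast
  qed
qed

lemma length_bound:
  assumes "l \<in> length_set M x"
  shows "l * \<alpha> \<le> v x"
proof -
  obtain A where A: "set_mset A \<subseteq> atoms M" "prod_mset A = x" "size A = l"
    using assms by (auto simp: length_set_def)
  have "size A * \<alpha> \<le> \<Sum>\<^sub># (image_mset v A)"
    using A(1) by (induction A) (auto dest: atomD(3))
  then show ?thesis using v_prod_mset[of A] A atoms_subset by auto
qed

lemma finite_length_set: "finite (length_set M x)"
proof (rule finite_subset)
  show "length_set M x \<subseteq> {..v x}"
  proof
    fix l assume "l \<in> length_set M x"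
    then have "l * \<alpha> \<le> v x" by (rule length_bound)
    moreover have "l \<le> l * \<alpha>" using \<alpha> by simp
    ultimately have "l \<le> v x" by (rule order_trans[rotated])
    then show "l \<in> {..v x}" by simp
  qed
qed simp

lemma length_set_mult:
  assumes "l \<in> length_set M x" "k \<in> length_set M y"
  shows "l + k \<in> length_set M (x * y)"
proof -
  obtain A B where "set_mset A \<subseteq> atoms M" "prod_mset A = x" "size A = l"
    "set_mset B \<subseteq> atoms M" "prod_mset B = y" "size B = k"
    using assms by (auto simp: length_set_def)
  then have "set_mset (A + B) \<subseteq> atoms M \<and> prod_mset (A + B) = x * y \<and> size (A + B) = l + k" by auto
  then show ?thesis unfolding length_set_def by blast
qed

lemma length_set_atom: "x \<in> atoms M \<Longrightarrow> 1 \<in> length_set M x"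
  unfolding length_set_def by (auto intro!: exI[of _ "{#x#}"])

lemma length_pos:
  assumes "l \<in> length_set M x" "x \<noteq> 1"
  shows "1 \<le> l"
  using assms by (auto simp: length_set_def Suc_le_eq intro!: Nat.gr0I)

text \<open>
  \<open>W\<close> is a minimal partial product of valuation at least \<open>\<alpha> + \<beta>\<close> and has \<open>|S| + 1\<close> factors; it is
  replaced by \<open>p\<^sup>\<beta>\<close> and \<open>t\<close> atoms of \<open>z\<close>. The only delicate case is \<open>|S| = 1\<close> with \<open>z\<close> still
  of valuation at least \<open>\<alpha> + \<beta>\<close>: there a second \<open>p\<^sup>\<beta>\<close> is split off, so as to have \<open>t = 2\<close>.
\<close>
lemma length_near_split_off:
  assumes l: "l \<in> length_set M (p ^ \<beta> * y)" and v: "\<alpha> + \<beta> \<le> v (p ^ \<beta> * y)"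
  obtains t where "t \<in> length_set M y" "l \<le> Suc t + \<delta>" "Suc t \<le> l + \<delta>"
proof -
  obtain A where A: "set_mset A \<subseteq> atoms M" "prod_mset A = p ^ \<beta> * y" "size A = l"
    using l by (auto simp: length_set_def)
  have AM: "set_mset A \<subseteq> M" using A atoms_subset by blast
  obtain S c where S: "add_mset c S \<subseteq># A" "\<Sum>\<^sub># (image_mset v S) < \<alpha> + \<beta>" "\<alpha> + \<beta> \<le> \<Sum>\<^sub># (image_mset v S) + v c"
    by (rule exists_submultiset_crossing[of "\<alpha> + \<beta>" v A]) (use v v_prod_mset[OF AM] A(2) \<alpha> in auto)
  define R where "R = A - add_mset c S"
  have AR: "A = add_mset c S + R"
    unfolding R_def by (rule subset_mset.add_diff_inverse[OF S(1), symmetric])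
  have SA: "set_mset S \<subseteq> atoms M" "c \<in> atoms M" "set_mset R \<subseteq> atoms M" using A(1) unfolding AR by auto
  have SM: "set_mset S \<subseteq> M" "c \<in> M" using SA atoms_subset by auto
  define W where "W = c * prod_mset S"
  have W: "W \<in> M" unfolding W_def using SM by (intro M_mult M_prod_mset) auto
  have vW: "v W = v c + \<Sum>\<^sub># (image_mset v S)"
    unfolding W_def using SM by (simp add: v_mult M_pos M_prod_mset v_prod_mset)
  then have "\<alpha> + \<beta> \<le> v W" using S by simp
  then obtain z where z: "z \<in> M" "z \<noteq> 1" "W = p ^ \<beta> * z" "v W = \<beta> + v z"
    using split_off_p_power[OF W] by blast
  have "p ^ \<beta> * y = p ^ \<beta> * (z * prod_mset R)"
  proof -
    have "p ^ \<beta> * y = W * prod_mset R" using A(2) unfolding AR W_def by simp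
    then show ?thesis unfolding z(3) by (simp only: mult.assoc)
  qed
  then have y: "y = z * prod_mset R" using p by (simp add: prime_gt_0_nat)
  have R: "size R \<in> length_set M (prod_mset R)" using SA unfolding length_set_def by blast
  have ln: "l = Suc (size S) + size R" using A(3) unfolding AR by simp
  have vc: "v c < \<alpha> + \<beta>" using SA by (intro atomD)
  have vS: "size S * \<alpha> \<le> \<Sum>\<^sub># (image_mset v S)"
    using SA(1) by (induction S) (auto dest: atomD(3))
  then have "(size S - 1) * \<alpha> < \<beta>" using S(2) \<beta>(2) by (cases "size S") auto
  then have sS: "size S \<le> Suc \<delta>" using le_\<delta>I[of "size S - 1"] by simp
  have "S \<noteq> {#}" using S(3) vc by (intro notI) simp
  then have S1: "1 \<le> size S" by (simp add: Suc_le_eq nonempty_has_size)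
  \<comment> \<open>The valuations of \<open>c\<close> and of the product of \<open>S\<close> are at
    most \<open>\<alpha> + \<beta> - 1\<close> each, and \<open>\<beta>\<close> has been
    removed.\<close>
  have vz: "v z + 2 \<le> 2 * \<alpha> + \<beta>" using z(4) vW S(2) vc by simp
  have "\<exists>t\<in>length_set M z. size S \<le> t + \<delta> \<and> t \<le> size S + \<delta>"
  proof (cases "size S = 1 \<and> \<alpha> + \<beta> \<le> v z")
    case True
    then obtain z' where z': "z' \<in> M" "z' \<noteq> 1" "z = p ^ \<beta> * z'" "v z = \<beta> + v z'"
      using split_off_p_power[OF z(1)] by blast
    \<comment> \<open>The valuation of \<open>z'\<close> is at most \<open>2 * \<alpha> - 2\<close>,
      too small for a decomposition.\<close>
    then have "z' \<in> atoms M" using vz by (intro atomI) auto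
    then have "1 + 1 \<in> length_set M z"
      unfolding z'(3) using p_power_atom by (intro length_set_mult length_set_atom)
    then show ?thesis using True \<delta>_pos by (intro bexI[of _ "1 + 1"]) auto
  next
    case False
    obtain t where t: "t \<in> length_set M z" using length_set_nonempty[OF z(1)] by blast
    have t1: "1 \<le> t" using length_pos[OF t z(2)] .
    have tv: "t * \<alpha> \<le> v z" using length_bound[OF t] .
    have "t \<le> size S + \<delta>"
    proof (cases "size S = 1")
      case True
      then have "v z < \<alpha> + \<beta>" using False by simp
      then have "(t - 1) * \<alpha> < \<beta>" using tv t1 by (cases t) auto
      then show ?thesis using le_\<delta>I[of "t - 1"] True by simp
    next
      case False
      \<comment> \<open>With at least two atoms in \<open>S\<close>, the weaker bound
        \<open>t \<le> \<delta> + 2\<close> suffices.\<close>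
      have "(t - 2) * \<alpha> < \<beta>"
      proof (cases "2 \<le> t")
        case True
        then obtain s where "t = 2 + s" using le_Suc_ex by blast
        then show ?thesis using tv vz by (simp add: algebra_simps)
      qed (use \<beta>(2) in simp)
      then show ?thesis using le_\<delta>I[of "t - 2"] False S1 by simp
    qed
    then show ?thesis using t t1 sS by (intro bexI[of _ t]) auto
  qed
  then obtain t where t: "t \<in> length_set M z" "size S \<le> t + \<delta>" "t \<le> size S + \<delta>" by blast
  show ?thesis
  proof (rule that[of "t + size R"])
    show "t + size R \<in> length_set M y" unfolding y by (rule length_set_mult[OF t(1) R])
  qed (use t ln in auto)
qed

text \<open>Induction by splitting off \<open>p ^ \<beta>\<close> as long as the valuation allows
  it. Below \<open>\<alpha> + \<beta>\<close> every positive length \<open>l\<close> satisfies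
  \<open>(l - 1) * \<alpha> < \<beta>\<close> and thus lies in
  \<open>{1..\<delta> + 1}\<close>.\<close>

lemma gaps_length_set:
  assumes "x \<in> M"
  shows "gaps_at_most \<delta> (length_set M x)"
  using assms
proof (induction x rule: less_induct)
  case (less x)
  show ?case
  proof (cases "\<alpha> + \<beta> \<le> v x")
    case True
    then obtain y where y: "y \<in> M" "x = p ^ \<beta> * y" using split_off_p_power[OF less.prems] by blast
    have "1 < p ^ \<beta>" using p \<beta>(2) prime_gt_1_nat by (intro one_less_power) auto
    then have "y < x" using y M_pos by simp
    note IH = less.IH[OF this y(1)]
    show ?thesis
    proof (rule gaps_at_most_extend)
      show "gaps_at_most \<delta> (Suc ` length_set M y)"
        using IH unfolding gaps_at_most_def by auto
      show "Suc ` length_set M y \<subseteq> length_set M x"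
        using length_set_mult[OF length_set_atom[OF p_power_atom]] y(2) by auto
      show "\<exists>t\<in>Suc ` length_set M y. t \<le> l + \<delta> \<and> l \<le> t + \<delta>" if "l \<in> length_set M x" for l
        using length_near_split_off[of l y] that True y(2) by (metis image_eqI)
    qed
  next
    case False
    show ?thesis
      unfolding gaps_at_most_def
    proof (intro ballI impI)
      fix l l' assume l: "l \<in> length_set M x" "l' \<in> length_set M x" "l < l'"
      have b: "l' * \<alpha> \<le> v x" using length_bound[OF l(2)] .
      have "x \<noteq> 1" using b l(3) \<alpha> by auto
      then have "1 \<le> l" using length_pos[OF l(1)] by simp
      have "(l' - 1) * \<alpha> < \<beta>" using b False l(3) by (cases l') auto
      then have "l' \<le> l + \<delta>" using le_\<delta>I[of "l' - 1"] \<open>1 \<le> l\<close> by simp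
      then show "\<exists>m\<in>length_set M x. l < m \<and> m \<le> l + \<delta>" using l by blast
    qed
  qed
qed

lemma length_density_ge:
  assumes "x \<in> length_irregular M"
  shows "1 / real \<delta> \<le> length_density M x"
proof -
  have x: "x \<in> M" and ne: "length_spread M x \<noteq> 0" using assms by (auto simp: length_irregular_def)
  define S where "S = length_set M x"
  have S: "finite S" "S \<noteq> {}" using finite_length_set length_set_nonempty[OF x] by (auto simp: S_def)
  have "Max S \<le> Min S + \<delta> * (card S - 1)"
    using gaps_at_most_Max_le[OF gaps_length_set[OF x]] S by (simp add: S_def)
  then have "real (Max S) \<le> real (Min S + \<delta> * (card S - 1))" by (simp only: of_nat_le_iff)
  moreover have "real (card S - 1) = real (card S) - 1"
    using S by (simp add: of_nat_diff Suc_le_eq card_gt_0_iff)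
  ultimately have le: "real_of_int (length_spread M x) \<le> real \<delta> * (real (card S) - 1)"
    by (simp add: length_spread_def S_def)
  have "Min S \<le> Max S" using S by simp
  then have "0 < length_spread M x" using ne by (simp add: length_spread_def S_def)
  then show ?thesis
    using le \<delta>_pos by (simp add: length_density_def S_def[symmetric] divide_simps mult.commute)
qed

section \<open>An element with exactly two lengths\<close>

text \<open>An \<open>m\<close> below \<open>\<alpha>\<close> escapes the minimality of
  \<open>\<beta>\<close>, since \<open>p ^ m\<close> is outside \<open>M\<close>; but then a
  multiple of \<open>m\<close> lies in \<open>{\<alpha>..<2 * \<alpha>}\<close> and would be an
  exponent smaller than \<open>\<beta>\<close>.\<close>

lemma cong_power_ge_\<beta>:
  assumes big: "2 * \<alpha> \<le> \<beta>" and m: "0 < m" "[p ^ m = 1] (mod f)"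
  shows "\<beta> \<le> m"
proof -
  have vp: "v (p ^ i) = i" for i using p by simp
  have in_M: "p ^ i \<in> M" if "\<alpha> \<le> i" "[p ^ i = 1] (mod f)" for i
    using that M_iff_v[of "p ^ i"] vp[of i] prime_gt_0_nat[OF p] by simp
  show ?thesis
  proof (cases "\<alpha> \<le> m")
    case True
    then show ?thesis using \<beta>(3)[OF m(1) in_M] m(2) by simp
  next
    case False
    \<comment> \<open>\<open>k\<close> is the quotient \<open>\<alpha> / m\<close> rounded
      up.\<close>
    define k where "k = (\<alpha> + m - 1) div m"
    have "k * m \<le> \<alpha> + m - 1" "\<alpha> + m - 1 < k * m + m"
      using m(1) div_times_less_eq_dividend[of "\<alpha> + m - 1" m] dividend_less_div_times[of m "\<alpha> + m - 1"]
      unfolding k_def by auto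
    then have k: "\<alpha> \<le> m * k" "m * k < 2 * \<alpha>" using False m(1) by (auto simp: mult.commute)
    have "[p ^ (m * k) = 1] (mod f)" using cong_pow[OF m(2), of k] by (simp add: power_mult)
    then have "\<beta> \<le> m * k" using \<beta>(3)[of "m * k"] in_M[OF k(1)] k(1) \<alpha> by linarith
    then show ?thesis using big k by simp
  qed
qed

text \<open>A length \<open>l\<close> strictly between the two is excluded by counting factors
  \<open>u\<close>: every atom contains one, some atom \<open>a\<close> has at least two, and
  comparing \<open>a\<close> with a power of \<open>p ^ \<alpha> * u\<close> shows that it contains
  all \<open>\<delta> + 2\<close> of them, leaving none for the others.\<close>

lemma extremal_length_set:
  assumes u: "prime u" "u \<noteq> p" "[p ^ \<alpha> * u = 1] (mod f)"
  defines "x \<equiv> (p ^ \<alpha> * u) ^ (\<delta> + 2)"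
  shows "x \<in> M" and "length_set M x = {2, \<delta> + 2}"
proof -
  have pos: "0 < p" "0 < u" using p u(1) by (auto simp: prime_gt_0_nat)
  have "\<not> p dvd u" "\<not> u dvd p" using p u primes_dvd_imp_eq by blast+
  then have npu: "\<not> p dvd u ^ j" "\<not> u dvd p ^ j" for j
    using p u(1) prime_dvd_power by blast+
  have vpu: "v (p ^ i * u ^ j) = i" for i j
    using pos p npu(1)[of j] by (simp add: v_mult not_dvd_imp_multiplicity_0)
  have wpu: "multiplicity u (p ^ i * u ^ j) = j" for i j
    using pos u(1) npu(2)[of i]
    by (simp add: prime_elem_multiplicity_mult_distrib prime_imp_prime_elem not_dvd_imp_multiplicity_0)
  \<comment> \<open>\<open>n\<close> is the valuation left after removing
    \<open>p ^ \<beta>\<close>; the choice of \<open>\<delta>\<close> places it in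
    \<open>{\<alpha>..<2 * \<alpha>}\<close>, which makes \<open>y\<close> an atom.\<close>
  define n where "n = (\<delta> + 2) * \<alpha> - \<beta>"
  have n: "\<alpha> \<le> n" "n < 2 * \<alpha>" "\<beta> + n = (\<delta> + 2) * \<alpha>"
    using \<delta>_bounds unfolding n_def by (auto simp: algebra_simps)
  have x_eq: "x = p ^ ((\<delta> + 2) * \<alpha>) * u ^ (\<delta> + 2)"
    unfolding x_def power_mult_distrib power_mult[symmetric] by (simp only: mult.commute)
  define y where "y = p ^ n * u ^ (\<delta> + 2)"
  have x_y: "x = p ^ \<beta> * y"
    unfolding x_eq y_def n(3)[symmetric] power_add by (simp only: mult.assoc)
  have x_cong: "[x = 1] (mod f)" unfolding x_def using cong_pow[OF u(3), of "\<delta> + 2"] by simp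
  have y_cong: "[y = 1] (mod f)" using x_cong \<beta>_cong unfolding x_y by (rule cong_cancel)
  have in_M: "p ^ i * u ^ j \<in> M" if "\<alpha> \<le> i" "[p ^ i * u ^ j = 1] (mod f)" for i j
    using that M_iff_v[of "p ^ i * u ^ j"] vpu[of i j] pos by simp
  have v1: "v 1 = 0" by simp
  have ne1: "p ^ i * u ^ j \<noteq> 1" if "0 < i" for i j
    using vpu[of i j] v1 that by (metis less_irrefl)
  have y: "y \<in> atoms M"
  proof (rule atomI)
    show "y \<in> M" unfolding y_def using n(1) y_cong[unfolded y_def] by (rule in_M)
    show "y \<noteq> 1" unfolding y_def using n(1) \<alpha> by (intro ne1) simp
    show "v y < 2 * \<alpha>" unfolding y_def vpu by (rule n(2))
  qed
  have b: "p ^ \<alpha> * u \<in> M" using in_M[of \<alpha> 1] u(3) by simp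
  have b_atom: "p ^ \<alpha> * u \<in> atoms M"
    using ne1[of \<alpha> 1] vpu[of \<alpha> 1] \<alpha> by (intro atomI b) auto
  show x_M: "x \<in> M" unfolding x_eq using x_cong[unfolded x_eq] by (intro in_M) auto
  have vx: "v x = (\<delta> + 2) * \<alpha>" unfolding x_eq by (rule vpu)
  have wx: "multiplicity u x = \<delta> + 2" unfolding x_eq by (rule wpu)
  have x1: "x \<noteq> 1" using vx v1 \<alpha> by auto

  have two: "2 \<in> length_set M x"
    using length_set_mult[OF length_set_atom[OF p_power_atom] length_set_atom[OF y]]
    unfolding x_y by (simp add: numeral_2_eq_2)
  have many: "\<delta> + 2 \<in> length_set M x"
  proof -
    have "set_mset (replicate_mset (\<delta> + 2) (p ^ \<alpha> * u)) \<subseteq> atoms M" using b_atom by auto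
    moreover have "prod_mset (replicate_mset (\<delta> + 2) (p ^ \<alpha> * u)) = x"
      unfolding x_def by (rule prod_mset_replicate_mset)
    moreover have "size (replicate_mset (\<delta> + 2) (p ^ \<alpha> * u)) = \<delta> + 2" by (rule size_replicate_mset)
    ultimately show ?thesis unfolding length_set_def by blast
  qed
  have "l = 2 \<or> l = \<delta> + 2" if l: "l \<in> length_set M x" for l
  proof (rule ccontr)
    assume ne: "\<not> ?thesis"
    obtain A where A: "set_mset A \<subseteq> atoms M" "prod_mset A = x" "size A = l"
      using l by (auto simp: length_set_def)
    have AM: "set_mset A \<subseteq> M" using A atoms_subset by blast
    have "l * \<alpha> \<le> (\<delta> + 2) * \<alpha>" using length_bound[OF l] unfolding vx .
    then have "l \<le> \<delta> + 2" using \<alpha> by (simp only: mult_le_cancel2)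
    moreover have "l \<noteq> 1"
    proof
      assume "l = 1"
      then obtain a where "A = {#a#}" using A(3) size_1_singleton_mset by blast
      then have "x \<in> atoms M" using A by simp
      then show False
        using x_y atomD[OF p_power_atom] atomD[OF y] by (auto simp: atoms_def)
    qed
    moreover have "1 \<le> l" by (rule length_pos[OF l x1])
    ultimately have l3: "3 \<le> l" "l \<le> \<delta> + 1" using ne by auto
    \<comment> \<open>Such a length exists only for \<open>\<delta> \<ge> 2\<close>, which gives the
      hypothesis of \<open>cong_power_ge_\<beta>\<close>.\<close>
    then have "2 * \<alpha> \<le> \<delta> * \<alpha>" by (intro mult_right_mono) auto
    then have big: "2 * \<alpha> \<le> \<beta>" using \<delta>_bounds(1) by linarith

    define w where "w = multiplicity u"
    have w_mult: "w (x * y) = w x + w y" if "0 < x" "0 < y" for x y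
      using that u(1) by (simp add: w_def prime_elem_multiplicity_mult_distrib prime_imp_prime_elem)
    have w_sum: "\<Sum>\<^sub># (image_mset w B) = w (prod_mset B)" if "set_mset B \<subseteq> M" for B
      using that
    proof (induction B)
      case (add x B)
      then have "0 < x" "0 < prod_mset B" using M_pos M_prod_mset by auto
      from w_mult[OF this] show ?case using add by simp
    qed (simp add: w_def)
    have wA: "\<Sum>\<^sub># (image_mset w A) = \<delta> + 2" using w_sum[OF AM] A(2) wx by (simp add: w_def)
    have form: "a = p ^ v a * u ^ w a" if a: "a \<in># A" for a
    proof -
      have "a dvd p ^ ((\<delta> + 2) * \<alpha>) * u ^ (\<delta> + 2)"
        using a A(2) unfolding x_eq by (metis dvd_prod_mset)
      then obtain c d where cd: "a = c * d" "c dvd p ^ ((\<delta> + 2) * \<alpha>)" "d dvd u ^ (\<delta> + 2)"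
        using division_decomp by blast
      then obtain i j where "c = p ^ i" "d = u ^ j"
        using divides_primepow_nat[OF p] divides_primepow_nat[OF u(1)] by blast
      then show ?thesis using cd(1) vpu wpu by (simp add: w_def)
    qed
    \<comment> \<open>An atom without \<open>u\<close> is a power of \<open>p\<close>, of exponent
      at least \<open>\<beta>\<close>; the valuation left, at most \<open>n < 2 * \<alpha>\<close>,
      admits at most one further atom.\<close>
    have w1: "1 \<le> w a" if a: "a \<in># A" for a
    proof (rule ccontr)
      assume "\<not> 1 \<le> w a"
      then have w0: "w a = 0" by simp
      have "a = p ^ v a" using form[OF a] unfolding w0 power_0 mult_1_right .
      moreover have aat: "a \<in> atoms M" using a A(1) by blast
      ultimately have "p ^ v a \<in> M" "0 < v a" using atomD(1,3)[OF aat] \<alpha> by (metis, linarith)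
      then have va: "\<beta> \<le> v a" using \<beta>(3) by blast
      obtain R where R: "A = add_mset a R" using a by (metis insert_DiffM)
      have "size R \<in> length_set M (prod_mset R)" using A(1) unfolding R length_set_def by auto
      then have "size R * \<alpha> \<le> v (prod_mset R)" by (rule length_bound)
      moreover have "v a + v (prod_mset R) = (\<delta> + 2) * \<alpha>"
        using A(2) AM vx unfolding R by (auto simp: v_mult M_pos M_prod_mset)
      ultimately have "size R * \<alpha> < 2 * \<alpha>" using va n by linarith
      then have "size R < 2" by simp
      then show False using A(3) l3 unfolding R by simp
    qed
    have "\<exists>a\<in>#A. 2 \<le> w a"
    proof (rule ccontr)
      assume "\<not> ?thesis"
      then have "\<forall>a\<in>#A. w a \<le> 1" by auto
      then have "\<Sum>\<^sub># (image_mset w A) \<le> size A" by (induction A) (auto simp: le_Suc_eq)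
      then show False using wA A(3) l3 by simp
    qed
    then obtain a where a: "a \<in># A" "2 \<le> w a" by blast
    have aat: "a \<in> atoms M" using a A(1) by blast
    define i j where "i = v a" and "j = w a"
    have a_eq: "a = p ^ i * u ^ j" using form[OF a(1)] by (simp add: i_def j_def)
    have a_cong: "[p ^ i * u ^ j = 1] (mod f)" using M_cong[OF atomD(1)[OF aat]] by (simp only: a_eq)
    have i: "\<alpha> \<le> i" using atomD(3)[OF aat] by (simp add: i_def)
    have j: "2 \<le> j" using a(2) by (simp add: j_def)
    \<comment> \<open>Otherwise \<open>p ^ \<alpha> * u\<close> could be split off from the atom
      \<open>a\<close>.\<close>
    have i2: "i < 2 * \<alpha>"
    proof (rule ccontr)
      assume "\<not> ?thesis"
      then have sub: "\<alpha> \<le> i - \<alpha>" by simp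
      have split: "p ^ i * u ^ j = (p ^ \<alpha> * u) * (p ^ (i - \<alpha>) * u ^ (j - 1))"
        using i j by (simp add: power_add[symmetric] power_Suc[symmetric] mult.assoc mult.left_commute[of u] del: power_Suc)
      have "[p ^ (i - \<alpha>) * u ^ (j - 1) = 1] (mod f)"
        by (rule cong_cancel[OF a_cong[unfolded split] u(3)])
      then have "p ^ (i - \<alpha>) * u ^ (j - 1) \<in> M - {1}"
        using in_M[OF sub] ne1[OF less_le_trans[OF \<alpha> sub]] by blast
      moreover have "p ^ \<alpha> * u \<in> M - {1}" using atomD[OF b_atom] by blast
      ultimately show False using aat split unfolding a_eq atoms_def by blast
    qed
    have "\<alpha> * 2 \<le> \<alpha> * j" using j by (rule mult_le_mono2)
    then have ij: "i < \<alpha> * j" using i2 by linarith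
    \<comment> \<open>The \<open>j\<close>-th power of \<open>p ^ \<alpha> * u\<close> is 1 modulo
      \<open>f\<close> and differs from \<open>a\<close> only by a power of \<open>p\<close>, which
      is therefore 1 as well.\<close>
    have "[(p ^ i * u ^ j) * p ^ (\<alpha> * j - i) = 1] (mod f)"
    proof -
      have "(p ^ i * u ^ j) * p ^ (\<alpha> * j - i) = (p ^ i * p ^ (\<alpha> * j - i)) * u ^ j" by (simp only: mult_ac)
      also have "\<dots> = (p ^ \<alpha> * u) ^ j"
        using ij by (simp add: power_add[symmetric] power_mult_distrib power_mult)
      finally show ?thesis using cong_pow[OF u(3), of j] by simp
    qed
    then have "[p ^ (\<alpha> * j - i) = 1] (mod f)" using a_cong by (rule cong_cancel)
    then have "\<beta> \<le> \<alpha> * j - i" using ij by (intro cong_power_ge_\<beta>[OF big]) auto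
    then have "(\<delta> + 1) * \<alpha> < j * \<alpha>" using \<delta>_bounds(1) i ij by (simp add: algebra_simps)
    then have "\<delta> + 1 < j" by (simp only: mult_less_cancel2)
    then have jq: "\<delta> + 2 \<le> j" by simp
    obtain R where R: "A = add_mset a R" using a by (metis insert_DiffM)
    have "size R \<noteq> 0" using A(3) l3 unfolding R size_add_mset by linarith
    then obtain c R' where "R = add_mset c R'" by (metis multiset_cases size_empty)
    then have "w a + w c \<le> \<Sum>\<^sub># (image_mset w A)" "1 \<le> w c" using w1[of c] unfolding R by auto
    then show False using wA jq by (simp add: j_def)
  qed
  then show "length_set M x = {2, \<delta> + 2}" using two many by blast
qed

lemma monoid_length_density_eq:
  assumes u: "prime u" "u \<noteq> p" "[p ^ \<alpha> * u = 1] (mod f)"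
  shows "monoid_length_density M = 1 / real \<delta>"
proof -
  define x where "x = (p ^ \<alpha> * u) ^ (\<delta> + 2)"
  note x = extremal_length_set[OF u, folded x_def]
  have spread: "length_spread M x = int \<delta>" unfolding length_spread_def x(2) by simp
  then have "x \<in> length_irregular M" using x(1) \<delta>_pos by (simp add: length_irregular_def)
  moreover have "length_density M x = 1 / real \<delta>"
    using \<delta>_pos unfolding length_density_def spread x(2) by simp
  ultimately have "1 / real \<delta> \<in> {length_density M x | x. x \<in> length_irregular M}"
    by (metis (mono_tags, lifting) mem_Collect_eq)
  then show ?thesis
    unfolding monoid_length_density_def
    by (rule cInf_eq_minimum) (use length_density_ge in auto)
qed

end

section \<open>From \<open>a\<close> and \<open>b\<close> to divisibility and residue
  conditions\<close>

text \<open>Writing \<open>a = p ^ \<alpha> * c\<close> with \<open>c\<close> coprime to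
  \<open>f\<close>, idempotency of \<open>a\<close> modulo \<open>b\<close> can be divided by
  \<open>p ^ \<alpha>\<close> and by \<open>c\<close>, so that \<open>a\<close> is 1 modulo
  \<open>f\<close>. Hence \<open>p\<close> is coprime to \<open>f\<close>, and the Chinese remainder
  theorem recombines the conditions.\<close>

lemma acm_iff:
  assumes "0 < a" "a \<le> b" "[a ^ 2 = a] (mod b)" "prime p" "0 < \<alpha>" "gcd a b = p ^ \<alpha>"
  defines "f \<equiv> b div p ^ \<alpha>"
  shows "0 < f" and "coprime p f"
    and "x \<in> acm a b \<longleftrightarrow> x = 1 \<or> (0 < x \<and> p ^ \<alpha> dvd x \<and> [x = 1] (mod f))"
proof -
  have pos: "0 < p ^ \<alpha>" using assms(4) by (simp add: prime_gt_0_nat)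
  have pdvd: "p ^ \<alpha> dvd a" "p ^ \<alpha> dvd b" unfolding assms(6)[symmetric] by simp_all
  have b: "b = p ^ \<alpha> * f" using pdvd(2) unfolding f_def by simp
  show f: "0 < f" using b assms(1,2) by (intro Nat.gr0I) auto
  obtain c where c: "a = p ^ \<alpha> * c" using pdvd(1) by blast
  have "p ^ \<alpha> * gcd c f = p ^ \<alpha> * 1" using assms(6) unfolding c b gcd_mult_distrib_nat by simp
  then have "gcd c f = 1" unfolding mult_cancel1 using pos by linarith
  then have cop: "coprime c f" by (simp only: coprime_iff_gcd_eq_1)
  have "[a * a = a * 1] (mod b)" using assms(3) by (simp add: power2_eq_square)
  then have "[p ^ \<alpha> * (c * a) = p ^ \<alpha> * c] (mod p ^ \<alpha> * f)" using b c by (simp add: mult.assoc)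
  then have "[c * a = c * 1] (mod f)" using pos by (auto simp: Cong.cong_def mult_mod_right[symmetric])
  then have a1: "[a = 1] (mod f)" using cop by (simp only: cong_mult_lcancel_nat)
  then have "coprime a f" using cong_imp_coprime cong_sym coprime_1_left by blast
  then have cpf: "coprime (p ^ \<alpha>) f" unfolding c by simp
  then show "coprime p f" using assms(5) by simp
  show "x \<in> acm a b \<longleftrightarrow> x = 1 \<or> (0 < x \<and> p ^ \<alpha> dvd x \<and> [x = 1] (mod f))"
  proof
    assume "x \<in> acm a b"
    then consider k where "x = a + b * k" | "x = 1" by (auto simp: acm_def)
    then show "x = 1 \<or> (0 < x \<and> p ^ \<alpha> dvd x \<and> [x = 1] (mod f))"
    proof cases
      case 1
      have "[x = a] (mod f)" unfolding 1 b by (simp add: Cong.cong_def mult.assoc mult.left_commute[of _ f])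
      then have "[x = 1] (mod f)" using a1 by (rule cong_trans)
      then show ?thesis using 1 assms(1) pdvd by simp
    qed simp
  next
    assume x: "x = 1 \<or> (0 < x \<and> p ^ \<alpha> dvd x \<and> [x = 1] (mod f))"
    show "x \<in> acm a b"
    proof (cases "x = 1")
      case False
      with x have x: "0 < x" "p ^ \<alpha> dvd x" "[x = 1] (mod f)" by auto
      have "[x = a] (mod f)" using x(3) a1 cong_trans cong_sym by blast
      moreover have "[x = a] (mod p ^ \<alpha>)" using x(2) pdvd(1) by (simp add: Cong.cong_def mod_eq_0_iff_dvd[THEN iffD2])
      ultimately have "[x = a] (mod b)" unfolding b using coprime_cong_mult_nat cpf by blast
      then have mod: "x mod b = a mod b" by (simp add: Cong.cong_def)
      \<comment> \<open>\<open>a\<close> is its own remainder only for \<open>a < b\<close>; for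
        \<open>a = b\<close> the remainder is 0, and positivity of \<open>x\<close> yields
        \<open>x \<ge> b\<close>.\<close>
      have "\<exists>k. x = a + b * k"
      proof (cases "a = b")
        case True
        then have "b dvd x" using mod by (simp add: mod_eq_0_iff_dvd)
        then obtain k where "x = b * k" by blast
        then have "x = a + b * (k - 1)" using x(1) True by (cases k) auto
        then show ?thesis by blast
      next
        case False
        then have "x = a + b * (x div b)" using mod assms(2) mult_div_mod_eq[of b x] by simp
        then show ?thesis by blast
      qed
      then show ?thesis by (auto simp: acm_def)
    qed (simp add: acm_def)
  qed
qed

text \<open>Dirichlet's theorem is applied modulo \<open>f * p\<close>, with residue 1 modulo \<open>p\<close>, to force \<open>u \<noteq> p\<close>.\<close>
lemma prime_inverse_residue_class:
  fixes p f k :: nat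
  assumes "0 < f" "coprime p f" "prime p"
  obtains u where "prime u" "u \<noteq> p" "[p ^ k * u = 1] (mod f)"
proof -
  have "coprime (p ^ k) f" using assms(2) by simp
  from cong_solve_coprime_nat[OF this] obtain c where c: "[p ^ k * c = 1] (mod f)" by auto
  obtain d where d: "[d = c] (mod f)" "[d = 1] (mod p)"
    using binary_chinese_remainder_nat[of f p c 1] assms(2) by (auto simp: coprime_commute)
  have pd: "[p ^ k * d = 1] (mod f)" using cong_scalar_left[OF d(1), of "p ^ k"] c by (rule cong_trans)
  then have "coprime (p ^ k * d) f" using cong_imp_coprime cong_sym coprime_1_left by blast
  then have "coprime d f" by simp
  moreover have "coprime d p" using d(2) cong_imp_coprime cong_sym coprime_1_left by blast
  ultimately obtain u where u: "prime u" "[u = d] (mod (f * p))"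
    using dirichlet_prime_in_residue_class[of "f * p" d] assms prime_gt_0_nat by auto
  have "[u = d] (mod f)" "[u = d] (mod p)"
    using u(2) cong_dvd_modulus_nat[of u d "f * p"] by auto
  then have "[p ^ k * u = 1] (mod f)" "[u = 1] (mod p)"
    using cong_trans[OF cong_scalar_left pd] cong_trans d(2) by blast+
  moreover from this have "u \<noteq> p" using prime_gt_1_nat[OF assms(3)] by (auto simp: Cong.cong_def)
  ultimately show ?thesis using that u(1) by blast
qed

lemma delta_eq:
  assumes "0 < \<alpha>" "0 < \<beta>"
  shows "delta \<alpha> \<beta> = int ((\<beta> - 1) div \<alpha>)"
  unfolding delta_def
proof (rule Greatest_equality)
  define q where "q = (\<beta> - 1) div \<alpha>"
  have q: "q * \<alpha> < \<beta>" "\<beta> \<le> q * \<alpha> + \<alpha>"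
    using assms div_times_less_eq_dividend[of "\<beta> - 1" \<alpha>] dividend_less_div_times[of \<alpha> "\<beta> - 1"]
    unfolding q_def by linarith+
  from q(1) have "real (q * \<alpha>) < real \<beta>" by (simp only: of_nat_less_iff)
  then show "real_of_int (int ((\<beta> - 1) div \<alpha>)) < real \<beta> / real \<alpha>"
    unfolding q_def[symmetric] using assms by (simp add: pos_less_divide_eq)
  fix y :: int assume "real_of_int y < real \<beta> / real \<alpha>"
  then have "real_of_int (y * int \<alpha>) < real_of_int (int \<beta>)" using assms by (simp add: pos_less_divide_eq)
  then have "y * int \<alpha> < int \<beta>" by (simp only: of_int_less_iff)
  also have "\<dots> \<le> int (q * \<alpha> + \<alpha>)" using q(2) by (simp only: of_nat_le_iff)
  also have "\<dots> = (int q + 1) * int \<alpha>" by (simp add: algebra_simps)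
  finally have "y < int q + 1" using assms(1) by (simp only: mult_less_cancel_right)
  then show "y \<le> int ((\<beta> - 1) div \<alpha>)" by (simp add: q_def)
qed

theorem proposition4p6:
  fixes a b p \<alpha> \<beta> :: nat
  assumes "0 < a" and "a \<le> b" and "[a ^ 2 = a] (mod b)"
    and "prime p" and "0 < \<alpha>" and "gcd a b = p ^ \<alpha>"
    and "\<beta> = (LEAST n. 0 < n \<and> p ^ n \<in> acm a b)"
    and "\<alpha> \<noteq> \<beta>"
  shows "monoid_length_density (acm a b) = 1 / real_of_int (delta \<alpha> \<beta>)"
proof -
  define f where "f = b div p ^ \<alpha>"
  note f = acm_iff(1,2)[OF assms(1-6), folded f_def]
  note M = acm_iff(3)[OF assms(1-6), folded f_def]
  have p1: "1 < p" using prime_gt_1_nat[OF assms(4)] .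
  \<comment> \<open>The minimum defining \<open>\<beta>\<close> is attained: Euler's theorem gives
    the residue 1, and the factor \<open>\<alpha>\<close> makes the exponent at least
    \<open>\<alpha>\<close>.\<close>
  have "[(p ^ totient f) ^ \<alpha> = 1] (mod f)" using cong_pow[OF euler_theorem[OF f(2)], of \<alpha>] by simp
  moreover have "\<alpha> \<le> totient f * \<alpha>" using f(1) by (simp add: Suc_le_eq)
  ultimately have "0 < totient f * \<alpha> \<and> p ^ (totient f * \<alpha>) \<in> acm a b"
    using f(1) p1 assms(5) unfolding M by (simp add: power_mult le_imp_power_dvd)
  then have beta: "0 < \<beta> \<and> p ^ \<beta> \<in> acm a b" unfolding assms(7) by (rule LeastI)
  then have "p ^ \<alpha> dvd p ^ \<beta>" using p1 unfolding M by auto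
  then have "\<alpha> < \<beta>" using p1 assms(8) by (simp add: power_dvd_imp_le le_neq_implies_less)
  interpret local_singular_acm p \<alpha> \<beta> f "acm a b"
  proof
    show "\<beta> \<le> n" if "0 < n" "p ^ n \<in> acm a b" for n
      unfolding assms(7) using that by (intro Least_le) simp
  qed (use assms f beta \<open>\<alpha> < \<beta>\<close> M in auto)
  obtain u where u: "prime u" "u \<noteq> p" "[p ^ \<alpha> * u = 1] (mod f)"
    using prime_inverse_residue_class[OF f assms(4)] .
  have "delta \<alpha> \<beta> = int \<delta>" unfolding \<delta>_def by (rule delta_eq[OF assms(5) conjunct1[OF beta]])
  then show ?thesis using monoid_length_density_eq[OF u] by simp
qed

end
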